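(* Let $p$ be a prime, $\rho_1,\rho_2\in(0,1)$ with $\rho_1\neq\rho_2$, $c\in\mathbb{R}$, $M=\begin{bmatrix}\rho_1^{-1} & c\\ 0 & \rho_2^{-1}\end{bmatrix}$, and let $D=\{d_0,d_1,\dots,d_{p-1}\}\subset\mathbb{Z}^2$ be a set of $p$ distinct vectors with $d_0=(0,0)^*$, $d_1=(d_{1,1},0)^*$, $d_{1,1}\neq0$, such that $\mathcal{Z}(\widehat{\delta}_D)=\bigcup_{j=1}^{p-1}\left(\frac{j\bm{a}}{p}+\mathbb{Z}^2\right)$ for some $\bm{a}\in\mathcal{E}_p$. Let $\mu_{M,D}$ be the associated self-affine measure and put $c''=\frac{c}{\rho_1^{-1}-\rho_2^{-1}}$. If $c''\notin\mathbb{Q}$, then $\mu_{M,D}$ is not a spectral measure.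
   Context: $v^*$ denotes the (conjugate) transpose, so $(i_1,i_2)^*$ is a column vector. $\mathcal{E}_p=\{(i_1,i_2)^*: i_1,i_2\in\{1,\dots,p-1\}\}$. For a finite set $E\subset\mathbb{R}^2$, $\delta_E=\frac{1}{\#E}\sum_{e\in E}\delta_e$, where $\delta_e$ is the Dirac measure at $e$. For a compactly supported Borel probability measure $\mu$ on $\mathbb{R}^2$, $\widehat{\mu}(\xi)=\int e^{-2\pi i\langle\xi,x\rangle}\,d\mu(x)$, $\xi\in\mathbb{R}^2$; $\mathcal{Z}(f)$ is the set of zeros of $f$ in $\mathbb{R}^2$. The self-affine measure $\mu_{M,D}$ is the unique Borel probability measure satisfying $\mu=\frac{1}{\#D}\sum_{d\in D}\mu\circ\varphi_d^{-1}$ with $\varphi_d(x)=M^{-1}(x+d)$. A compactly supported Borel probability measure $\mu$ is a spectral measure if there is a countable $\Lambda\subset\mathbb{R}^2$ (a spectrum of $\mu$) such that $\{e^{-2\pi i\langle\lambda,x\rangle}:\lambda\in\Lambda\}$ is an orthonormal basis of $L^2(\mu)$. *)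

theory Defs
  imports "HOL-Probability.Probability" "HOL-Computational_Algebra.Primes"
begin

definition int_lattice :: "(real ^ 2) set" where
  "int_lattice = {x. \<forall>i. x $ i \<in> \<int>}"

definition E_set :: "nat \<Rightarrow> (real ^ 2) set" where
  "E_set p = {vector [real i1, real i2] | i1 i2. i1 \<in> {1..p - 1} \<and> i2 \<in> {1..p - 1}}"

(* The uniform measure on E is moved to the Borel sigma-algebra of the plane;
   see uniform_delta_eq for the expression as an average of Dirac measures.
   Only meaningful for finite nonempty E. *)
definition uniform_delta :: "(real ^ 2) set \<Rightarrow> (real ^ 2) measure" where
  "uniform_delta E = distr (uniform_count_measure E) borel (\<lambda>x. x)"

lemma uniform_delta_eq:
  assumes "finite E" "E \<noteq> {}" "A \<in> sets borel"
  shows "measure (uniform_delta E) A = (\<Sum>e\<in>E. measure (return borel e) A) / card E"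
proof -
  have "measure (uniform_delta E) A = measure (uniform_count_measure E) (A \<inter> E)"
    unfolding uniform_delta_def
    using assms by (subst measure_distr)
      (auto simp: space_uniform_count_measure sets_uniform_count_measure measurable_def)
  also have "\<dots> = card (A \<inter> E) / card E"
    using assms by (subst measure_uniform_count_measure) auto
  also have "real (card (A \<inter> E)) = (\<Sum>e\<in>E. measure (return borel e) A)"
    using assms by (simp add: measure_return indicator_def sum.If_cases Int_commute)
  finally show ?thesis .
qed

definition expo :: "real ^ 2 \<Rightarrow> real ^ 2 \<Rightarrow> complex" where
  "expo \<xi> x = exp (- 2 * of_real pi * \<i> * of_real (\<xi> \<bullet> x))"

definition fourier :: "(real ^ 2) measure \<Rightarrow> real ^ 2 \<Rightarrow> complex" where
  "fourier \<mu> \<xi> = (LINT x|\<mu>. expo \<xi> x)"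

definition zero_set :: "(real ^ 2 \<Rightarrow> complex) \<Rightarrow> (real ^ 2) set" where
  "zero_set f = {\<xi>. f \<xi> = 0}"

definition affine_map :: "real ^ 2 ^ 2 \<Rightarrow> real ^ 2 \<Rightarrow> real ^ 2 \<Rightarrow> real ^ 2" where
  "affine_map M d x = matrix_inv M *v (x + d)"

(* For an expanding M and a finite nonempty D exactly one measure satisfies this
   predicate (Hutchinson). *)
definition self_affine_measure ::
    "real ^ 2 ^ 2 \<Rightarrow> (real ^ 2) set \<Rightarrow> (real ^ 2) measure \<Rightarrow> bool" where
  "self_affine_measure M D \<mu> \<longleftrightarrow>
     prob_space \<mu> \<and> sets \<mu> = sets borel \<and>
     (\<forall>A\<in>sets borel.
        measure \<mu> A = (\<Sum>d\<in>D. measure (distr \<mu> borel (affine_map M d)) A) / card D)"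

definition square_integrable :: "(real ^ 2) measure \<Rightarrow> (real ^ 2 \<Rightarrow> complex) \<Rightarrow> bool" where
  "square_integrable \<mu> f \<longleftrightarrow>
     f \<in> borel_measurable \<mu> \<and> integrable \<mu> (\<lambda>x. (cmod (f x))\<^sup>2)"

(* An orthonormal basis is an orthonormal family with dense linear span in L^2.
   The family is indexed by \<Lambda>: distinct frequencies must give orthogonal exponentials. *)
definition is_spectrum :: "(real ^ 2) measure \<Rightarrow> (real ^ 2) set \<Rightarrow> bool" where
  "is_spectrum \<mu> \<Lambda> \<longleftrightarrow>
     countable \<Lambda> \<and>
     (\<forall>l\<in>\<Lambda>. \<forall>k\<in>\<Lambda>.
        (LINT x|\<mu>. expo l x * cnj (expo k x)) = (if l = k then 1 else 0)) \<and>
     (\<forall>f. square_integrable \<mu> f \<longrightarrow> (\<forall>\<epsilon>>0. \<exists>F b. finite F \<and> F \<subseteq> \<Lambda> \<and>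
        (LINT x|\<mu>. (cmod (f x - (\<Sum>l\<in>F. b l * expo l x)))\<^sup>2) < \<epsilon>))"

(* Intended for compactly supported Borel probability measures; this is not a
   conjunct, so that the negation denies the existence of a spectrum. *)
definition spectral_measure :: "(real ^ 2) measure \<Rightarrow> bool" where
  "spectral_measure \<mu> \<longleftrightarrow> (\<exists>\<Lambda>. is_spectrum \<mu> \<Lambda>)"

end

theory Submission
  imports Defs
begin

text \<open>
  Write \<open>\<gamma>\<close> for the slope \<open>c / (inverse \<rho>1 - inverse \<rho>2)\<close> and \<open>S\<close> for the inverse transpose of
  \<open>M\<close>. The matrix \<open>S\<close> has the eigenvectors \<open>(1, \<gamma>)\<close> and \<open>(0, 1)\<close> with eigenvalues below 1, and the Fourier
  transform of \<open>\<mu>\<close> is the infinite product of the factors \<open>mask D (S^n \<xi>)\<close> over \<open>n \<ge> 1\<close>, where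
  \<open>mask D\<close> is the Fourier transform of the digit measure. Hence any two distinct frequencies in a
  spectrum \<open>\<Lambda>\<close> have a level: an \<open>n\<close> such that \<open>S^n\<close> maps their difference to a zero of
  \<open>mask D\<close>, and such a zero is a vector \<open>v / p\<close> with \<open>v\<close> integral and its first coordinate prime to
  \<open>p\<close>. Completeness of the exponentials gives two facts about levels.

  \<^item> Every frequency has, for every \<open>n\<close>, a partner at level \<open>n\<close> (\<open>every_level_occurs\<close>).

  \<^item> The relation of being at level 1 is not transitive (\<open>first_level_not_transitive\<close>).

  Both come from one exchange argument. Singling out the \<open>n\<close>-th digit exhibits \<open>\<mu>\<close> as a convolution
  of a scaled digit measure with a measure \<open>\<nu>\<close>, and each exponential becomes a product of a vector on
  \<open>D\<close> and an exponential in \<open>L^2(\<nu>)\<close>. If some exponentials can be replaced by one product vector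
  without spoiling orthonormality, then Bessel's inequality for the new family, set against Parseval's
  identity for the old one, compares values of Fourier transforms at all points of the plane
  (\<open>exchange\<close>). A frequency without partner at level \<open>n\<close> would force \<open>mask D\<close> to have modulus 1
  arbitrarily close to 0 along the first axis; transitivity of level 1 would force the transform of
  \<open>\<mu>\<close> to have modulus 1 at a zero of \<open>mask D\<close>. The digit \<open>(d11, 0)\<close> excludes both.

  The rest is arithmetic. A triple violating transitivity shows that some power
  \<open>\<alpha> = inverse \<rho>1 ^ s\<close> is rational with numerator divisible by \<open>p\<close> (\<open>rational_expansion_power\<close>). Take
  partners of one frequency at the levels \<open>1\<close>, \<open>1 + s\<close> and \<open>1 + 2 * s\<close>. Comparing powers of \<open>p\<close> in the
  first coordinates shows that levels behave like an ultrametric here: the partners differ from each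
  other at the smaller of their two levels (\<open>level_of_difference\<close>). Consequently the difference
  between the third partner and the given frequency has rational images at all three levels, so a rational vector \<open>y\<close> with
  nonzero first coordinate stays rational under one and two applications of the map with
  eigenvalues \<open>\<alpha>\<close> and \<open>inverse \<rho>2 ^ s\<close>; this makes \<open>\<gamma>\<close> rational
  (\<open>rational_orbit_imp_rational_slope\<close>).
\<close>

section \<open>Characters and Fourier transforms\<close>

definition mask :: "(real ^ 2) set \<Rightarrow> real ^ 2 \<Rightarrow> complex" where
  "mask D \<xi> = (\<Sum>d\<in>D. expo \<xi> d) / of_nat (card D)"

lemma expo_add: "expo (\<xi> + \<eta>) x = expo \<xi> x * expo \<eta> x"
  by (simp add: expo_def inner_add_left ring_distribs exp_diff exp_minus field_simps)

lemma expo_add_point: "expo \<xi> (x + y) = expo \<xi> x * expo \<xi> y"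
  by (simp add: expo_def inner_add_right ring_distribs exp_diff exp_minus field_simps)

lemma cnj_expo: "cnj (expo \<xi> x) = expo (- \<xi>) x"
  by (simp add: expo_def exp_cnj)

lemma expo_diff: "expo (\<xi> - \<eta>) x = expo \<xi> x * cnj (expo \<eta> x)"
  using expo_add[of \<xi> "- \<eta>" x] by (simp add: cnj_expo)

lemma expo_0 [simp]: "expo 0 x = 1" "expo \<xi> 0 = 1"
  by (simp_all add: expo_def)

lemma norm_expo [simp]: "cmod (expo \<xi> x) = 1"
proof -
  have "expo \<xi> x = exp (\<i> * complex_of_real (- 2 * pi * (\<xi> \<bullet> x)))"
    by (simp add: expo_def algebra_simps)
  then show ?thesis
    by (metis norm_exp_i_times)
qed

lemma isCont_expo: "isCont (\<lambda>\<xi>. expo \<xi> x) \<xi>"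
  unfolding expo_def by (intro continuous_intros)

lemma measurable_expo [measurable]: "expo \<xi> \<in> borel_measurable borel"
  unfolding expo_def by (intro borel_measurable_continuous_onI continuous_intros)

lemma measurable_cnj [measurable]: "cnj \<in> borel_measurable borel"
  by (intro borel_measurable_continuous_onI continuous_intros)

lemma mask_0 [simp]: "finite D \<Longrightarrow> D \<noteq> {} \<Longrightarrow> mask D 0 = 1"
  by (simp add: mask_def)

lemma mask_minus: "mask D (- \<xi>) = cnj (mask D \<xi>)"
  by (simp add: mask_def cnj_expo)

lemma norm_mask_le: "cmod (mask D \<xi>) \<le> 1"
proof -
  have "cmod (\<Sum>d\<in>D. expo \<xi> d) \<le> real (card D)"
    using sum_norm_le[of D "expo \<xi>" "\<lambda>_. 1"] by simp
  then show ?thesis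
    by (simp add: mask_def norm_divide divide_le_eq)
qed

lemma fourier_uniform_delta:
  assumes "finite D" "D \<noteq> {}"
  shows "fourier (uniform_delta D) = mask D"
proof
  fix \<xi>
  have "id \<in> uniform_count_measure D \<rightarrow>\<^sub>M borel"
    by (auto simp: measurable_def sets_uniform_count_measure space_uniform_count_measure)
  then have "fourier (uniform_delta D) \<xi> = (LINT x|uniform_count_measure D. expo \<xi> x)"
    unfolding fourier_def uniform_delta_def
    by (subst integral_distr) (auto simp: id_def)
  also have "\<dots> = mask D \<xi>"
    using assms by (simp add: mask_def uniform_count_measure_def lebesgue_integral_point_measure_finite
      scaleR_conv_of_real sum_divide_distrib)
  finally show "fourier (uniform_delta D) \<xi> = mask D \<xi>" .
qed

lemma fourier_minus: "fourier \<mu> (- \<xi>) = cnj (fourier \<mu> \<xi>)"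
  using Bochner_Integration.integral_cnj[of \<mu> "expo \<xi>"] by (simp add: fourier_def cnj_expo)

lemma mean_expo: "(\<Sum>d\<in>D. expo x d * cnj (expo y d)) / of_nat (card D) = mask D (x - y)"
  by (simp add: mask_def expo_diff)

lemma fourier_0: "prob_space \<mu> \<Longrightarrow> fourier \<mu> 0 = 1"
  by (simp add: fourier_def prob_space.prob_space)

lemma tendsto_fourier:
  assumes "prob_space \<nu>" "sets \<nu> = sets borel" "X \<longlonglongrightarrow> \<xi>"
  shows "(\<lambda>n. fourier \<nu> (X n)) \<longlonglongrightarrow> fourier \<nu> \<xi>"
proof -
  interpret prob_space \<nu> by fact
  have [measurable_cong]: "sets \<nu> = sets borel" by fact
  show ?thesis
    unfolding fourier_def
  proof (rule integral_dominated_convergence[where w = "\<lambda>_. 1"])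
    show "AE x in \<nu>. (\<lambda>n. expo (X n) x) \<longlonglongrightarrow> expo \<xi> x"
      by (intro AE_I2 isCont_tendsto_compose[OF isCont_expo] assms)
  qed auto
qed

lemma norm_fourier_le:
  assumes "prob_space \<nu>" "sets \<nu> = sets borel"
  shows "cmod (fourier \<nu> \<xi>) \<le> 1"
proof -
  interpret prob_space \<nu> by fact
  have "cmod (fourier \<nu> \<xi>) \<le> (LINT x|\<nu>. cmod (expo \<xi> x))"
    unfolding fourier_def by (rule integral_norm_bound)
  then show ?thesis by (simp add: prob_space)
qed

lemma expo_eq_1_iff: "expo \<xi> x = 1 \<longleftrightarrow> \<xi> \<bullet> x \<in> \<int>"
proof
  assume "expo \<xi> x = 1"
  then obtain n :: int where "- 2 * pi * (\<xi> \<bullet> x) = of_int (2 * n) * pi"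
    unfolding expo_def exp_eq_1 by auto
  then have "\<xi> \<bullet> x = of_int (- n)"
    using mult_left_cancel[of pi "\<xi> \<bullet> x" "of_int (- n)"] by simp
  then show "\<xi> \<bullet> x \<in> \<int>" by (metis Ints_of_int)
next
  assume "\<xi> \<bullet> x \<in> \<int>"
  then obtain n where "\<xi> \<bullet> x = of_int n" by (auto elim: Ints_cases)
  then show "expo \<xi> x = 1"
    unfolding expo_def exp_eq_1 by (auto intro!: exI[of _ "- n"])
qed

text \<open>
  This is the equality case of the triangle inequality: a mean of unit complex numbers, one of which
  is the character value 1 at the digit 0, has modulus 1 only if all of them are 1.
\<close>

lemma mask_modulus_one:
  assumes "finite D" "0 \<in> D" "cmod (mask D \<xi>) \<ge> 1" "d \<in> D"
  shows "\<xi> \<bullet> d \<in> \<int>"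
proof (cases "d = 0")
  case False
  let ?z = "expo \<xi> d"
  have c: "card D = card (D - {0, d}) + 2"
    using assms False card_mono[of D "{0, d}"] by (subst card_Diff_subset) auto
  have pos: "real (card D) > 0" using c by simp
  have "(\<Sum>e\<in>D. expo \<xi> e) = (1 + ?z) + (\<Sum>e\<in>D - {0, d}. expo \<xi> e)"
    using sum.subset_diff[of "{0, d}" D "expo \<xi>"] assms False by (simp add: add.commute)
  then have "cmod (\<Sum>e\<in>D. expo \<xi> e) \<le> cmod (1 + ?z) + cmod (\<Sum>e\<in>D - {0, d}. expo \<xi> e)"
    by (metis norm_triangle_ineq)
  also have "cmod (\<Sum>e\<in>D - {0, d}. expo \<xi> e) \<le> card (D - {0, d})"
    using sum_norm_le[of "D - {0, d}" "expo \<xi>" "\<lambda>_. 1"] by simp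
  finally have "cmod (\<Sum>e\<in>D. expo \<xi> e) \<le> cmod (1 + ?z) + card (D - {0, d})" by simp
  moreover have "cmod (\<Sum>e\<in>D. expo \<xi> e) \<ge> card D"
    using assms(3) pos by (simp add: mask_def norm_divide le_divide_eq)
  ultimately have "2 \<le> cmod (1 + ?z)" using c by simp
  then have "2\<^sup>2 \<le> (cmod (1 + ?z))\<^sup>2" by (intro power_mono) auto
  moreover have "(Re ?z)\<^sup>2 + (Im ?z)\<^sup>2 = 1"
    using norm_expo[of \<xi> d] by (metis cmod_power2 power_one)
  moreover have "(cmod (1 + ?z))\<^sup>2 = (1 + Re ?z)\<^sup>2 + (Im ?z)\<^sup>2"
    by (simp add: cmod_power2)
  ultimately have re: "Re ?z \<ge> 1" and sq: "(Re ?z)\<^sup>2 + (Im ?z)\<^sup>2 = 1"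
    by (simp_all add: power2_sum)
  have "Re ?z = 1"
    using re abs_Re_le_cmod[of ?z] by simp
  with sq have "?z = 1" by (simp add: complex_eq_iff)
  then show ?thesis by (simp add: expo_eq_1_iff)
qed simp

section \<open>Orthonormal exponentials\<close>

context prob_space
begin

lemma integrable_bounded_by:
  fixes f :: "'a \<Rightarrow> complex"
  assumes "f \<in> borel_measurable M" "\<And>x. cmod (f x) \<le> C"
  shows "integrable M f"
  using assms by (intro integrable_const_bound[where B = C]) auto

text \<open>
  This identity has two uses. Dropping the last sum bounds the distance to every linear combination from
  below, which turns density of the span into an approximate Parseval identity; choosing the
  coefficients that annihilate the last sum gives Bessel's inequality.
\<close>

lemma sq_dist_orthonormal:
  fixes f :: "'a \<Rightarrow> complex" and e :: "'k \<Rightarrow> 'a \<Rightarrow> complex"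
  assumes fin: "finite K"
    and f: "f \<in> borel_measurable M" "\<And>x. cmod (f x) \<le> C"
    and e: "\<And>k. k \<in> K \<Longrightarrow> e k \<in> borel_measurable M" "\<And>k x. k \<in> K \<Longrightarrow> cmod (e k x) \<le> C"
    and on: "\<And>k l. k \<in> K \<Longrightarrow> l \<in> K \<Longrightarrow> (LINT x|M. e k x * cnj (e l x)) = (if k = l then 1 else 0)"
  shows "(LINT x|M. (cmod (f x - (\<Sum>k\<in>K. b k * e k x)))\<^sup>2) =
    (LINT x|M. (cmod (f x))\<^sup>2) - (\<Sum>k\<in>K. (cmod (LINT x|M. f x * cnj (e k x)))\<^sup>2)
      + (\<Sum>k\<in>K. (cmod (b k - (LINT x|M. f x * cnj (e k x))))\<^sup>2)"
proof -
  define q where "q k = (LINT x|M. f x * cnj (e k x))" for k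
  have [measurable]: "f \<in> borel_measurable M" by fact
  have [measurable]: "e k \<in> borel_measurable M" if "k \<in> K" for k
    using e that by blast
  have bnd: "cmod u \<le> C \<Longrightarrow> cmod v \<le> C \<Longrightarrow> cmod (u * cnj v) \<le> C * C" for u v
    by (simp add: norm_mult mult_mono')
  have i1: "integrable M (\<lambda>x. f x * cnj (f x))"
    using f by (intro integrable_bounded_by[where C = "C*C"] bnd) (auto intro!: measurable_compose[OF _ measurable_cnj] borel_measurable_times)
  have i2: "integrable M (\<lambda>x. f x * cnj (e k x))" if "k \<in> K" for k
    using f e that by (intro integrable_bounded_by[where C = "C*C"] bnd) (auto intro!: measurable_compose[OF _ measurable_cnj] borel_measurable_times)
  have i3: "integrable M (\<lambda>x. e k x * cnj (f x))" if "k \<in> K" for k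
    using f e that by (intro integrable_bounded_by[where C = "C*C"] bnd) (auto intro!: measurable_compose[OF _ measurable_cnj] borel_measurable_times)
  have i4: "integrable M (\<lambda>x. e k x * cnj (e l x))" if "k \<in> K" "l \<in> K" for k l
    using e that by (intro integrable_bounded_by[where C = "C*C"] bnd) (auto intro!: measurable_compose[OF _ measurable_cnj] borel_measurable_times)
  have q': "(LINT x|M. e k x * cnj (f x)) = cnj (q k)" for k
  proof -
    have "(LINT x|M. e k x * cnj (f x)) = (LINT x|M. cnj (f x * cnj (e k x)))"
      by (simp add: mult.commute)
    then show ?thesis
      unfolding q_def using Bochner_Integration.integral_cnj[of M "\<lambda>x. f x * cnj (e k x)"] by (rule trans)
  qed
  have "complex_of_real (LINT x|M. (cmod (f x - (\<Sum>k\<in>K. b k * e k x)))\<^sup>2) =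
      (LINT x|M. (f x - (\<Sum>k\<in>K. b k * e k x)) * cnj (f x - (\<Sum>k\<in>K. b k * e k x)))"
    by (simp only: complex_norm_square[symmetric] integral_complex_of_real)
  also have "\<dots> = (LINT x|M. f x * cnj (f x) - (\<Sum>k\<in>K. b k * (e k x * cnj (f x)))
      - (\<Sum>k\<in>K. cnj (b k) * (f x * cnj (e k x)))
      + (\<Sum>k\<in>K. \<Sum>l\<in>K. b k * cnj (b l) * (e k x * cnj (e l x))))"
  proof (rule Bochner_Integration.integral_cong[OF refl])
    fix x
    let ?S = "\<Sum>k\<in>K. b k * e k x"
    have "?S * cnj (f x) = (\<Sum>k\<in>K. b k * (e k x * cnj (f x)))"
      by (simp add: sum_distrib_right mult.assoc)
    moreover have "f x * cnj ?S = (\<Sum>k\<in>K. cnj (b k) * (f x * cnj (e k x)))"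
      by (simp add: sum_distrib_left mult.left_commute)
    moreover have "?S * cnj ?S = (\<Sum>k\<in>K. \<Sum>l\<in>K. b k * cnj (b l) * (e k x * cnj (e l x)))"
      by (simp add: sum_product mult_ac)
    ultimately show "(f x - ?S) * cnj (f x - ?S) = f x * cnj (f x)
      - (\<Sum>k\<in>K. b k * (e k x * cnj (f x))) - (\<Sum>k\<in>K. cnj (b k) * (f x * cnj (e k x)))
      + (\<Sum>k\<in>K. \<Sum>l\<in>K. b k * cnj (b l) * (e k x * cnj (e l x)))"
      by (simp add: left_diff_distrib right_diff_distrib)
  qed
  also have "\<dots> = (LINT x|M. f x * cnj (f x)) - (\<Sum>k\<in>K. b k * cnj (q k))
      - (\<Sum>k\<in>K. cnj (b k) * q k)
      + (\<Sum>k\<in>K. \<Sum>l\<in>K. b k * cnj (b l) * (if k = l then 1 else 0))"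
    using i1 i2 i3 i4 on by (simp add: q' q_def[symmetric])
  also have "(\<Sum>k\<in>K. \<Sum>l\<in>K. b k * cnj (b l) * (if k = l then 1 else 0)) = (\<Sum>k\<in>K. b k * cnj (b k))"
    using fin by (intro sum.cong) (auto simp: if_distrib cong: if_cong)
  also have "(LINT x|M. f x * cnj (f x)) - (\<Sum>k\<in>K. b k * cnj (q k))
      - (\<Sum>k\<in>K. cnj (b k) * q k) + (\<Sum>k\<in>K. b k * cnj (b k)) =
    (LINT x|M. f x * cnj (f x)) - (\<Sum>k\<in>K. q k * cnj (q k)) + (\<Sum>k\<in>K. (b k - q k) * cnj (b k - q k))"
    by (simp add: algebra_simps sum.distrib sum_subtractf)
  also have "(LINT x|M. f x * cnj (f x)) = complex_of_real (LINT x|M. (cmod (f x))\<^sup>2)"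
    by (simp only: complex_norm_square[symmetric] integral_complex_of_real)
  finally have "complex_of_real (LINT x|M. (cmod (f x - (\<Sum>k\<in>K. b k * e k x)))\<^sup>2) = complex_of_real (
    (LINT x|M. (cmod (f x))\<^sup>2) - (\<Sum>k\<in>K. (cmod (q k))\<^sup>2) + (\<Sum>k\<in>K. (cmod (b k - q k))\<^sup>2))"
    by (simp only: complex_norm_square[symmetric] of_real_sum of_real_add of_real_diff)
  then show ?thesis
    unfolding of_real_eq_iff q_def .
qed

lemma bessel_inequality:
  fixes f :: "'a \<Rightarrow> complex" and e :: "'k \<Rightarrow> 'a \<Rightarrow> complex"
  assumes "finite K"
    and "f \<in> borel_measurable M" "\<And>x. cmod (f x) \<le> C"
    and "\<And>k. k \<in> K \<Longrightarrow> e k \<in> borel_measurable M" "\<And>k x. k \<in> K \<Longrightarrow> cmod (e k x) \<le> C"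
    and "\<And>k l. k \<in> K \<Longrightarrow> l \<in> K \<Longrightarrow> (LINT x|M. e k x * cnj (e l x)) = (if k = l then 1 else 0)"
  shows "(\<Sum>k\<in>K. (cmod (LINT x|M. f x * cnj (e k x)))\<^sup>2) \<le> (LINT x|M. (cmod (f x))\<^sup>2)"
proof -
  have "0 \<le> (LINT x|M. (cmod (f x - (\<Sum>k\<in>K. (LINT x|M. f x * cnj (e k x)) * e k x)))\<^sup>2)"
    by (intro integral_nonneg_AE) auto
  then show ?thesis
    by (subst (asm) sq_dist_orthonormal[OF assms]) auto
qed

end

text \<open>
  Density of the exponentials is applied to the exponential of frequency \<open>\<xi>\<close> itself, whose
  inner products with the basis are values of the Fourier transform. Finite sums up to \<open>\<epsilon>\<close> are all that
  later comparisons with Bessel's inequality need.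
\<close>

lemma spectrum_almost_parseval:
  assumes "prob_space \<mu>" "sets \<mu> = sets borel" "is_spectrum \<mu> \<Lambda>" "\<epsilon> > 0"
  obtains F where "finite F" "F \<subseteq> \<Lambda>" "(\<Sum>l\<in>F. (cmod (fourier \<mu> (\<xi> - l)))\<^sup>2) > 1 - \<epsilon>"
proof -
  interpret prob_space \<mu> by fact
  have [measurable_cong]: "sets \<mu> = sets borel" by fact
  have meas: "expo l \<in> borel_measurable \<mu>" for l
    by measurable
  have on: "(LINT x|\<mu>. expo l x * cnj (expo k x)) = (if l = k then 1 else 0)"
    if "l \<in> \<Lambda>" "k \<in> \<Lambda>" for l k
    using assms(3) that unfolding is_spectrum_def by blast
  have sq: "square_integrable \<mu> (expo \<xi>)"
    using meas by (simp add: square_integrable_def)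
  have "\<forall>f. square_integrable \<mu> f \<longrightarrow> (\<forall>\<epsilon>>0. \<exists>F b. finite F \<and> F \<subseteq> \<Lambda> \<and>
        (LINT x|\<mu>. (cmod (f x - (\<Sum>l\<in>F. b l * expo l x)))\<^sup>2) < \<epsilon>)"
    using assms(3) unfolding is_spectrum_def by blast
  from this[rule_format, OF sq assms(4)] obtain F b where F: "finite F" "F \<subseteq> \<Lambda>"
    and *: "(LINT x|\<mu>. (cmod (expo \<xi> x - (\<Sum>l\<in>F. b l * expo l x)))\<^sup>2) < \<epsilon>"
    by blast
  have "(LINT x|\<mu>. (cmod (expo \<xi> x - (\<Sum>l\<in>F. b l * expo l x)))\<^sup>2) =
    (LINT x|\<mu>. (cmod (expo \<xi> x))\<^sup>2) - (\<Sum>l\<in>F. (cmod (LINT x|\<mu>. expo \<xi> x * cnj (expo l x)))\<^sup>2)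
      + (\<Sum>l\<in>F. (cmod (b l - (LINT x|\<mu>. expo \<xi> x * cnj (expo l x))))\<^sup>2)"
    using F meas by (intro sq_dist_orthonormal[where C = 1] on) auto
  moreover have "(\<Sum>l\<in>F. (cmod (b l - (LINT x|\<mu>. expo \<xi> x * cnj (expo l x))))\<^sup>2) \<ge> 0"
    by (intro sum_nonneg) auto
  ultimately have "(\<Sum>l\<in>F. (cmod (fourier \<mu> (\<xi> - l)))\<^sup>2) > 1 - \<epsilon>"
    using * by (simp add: fourier_def expo_diff prob_space)
  with F show ?thesis by (rule that)
qed

lemma spectrum_orthogonal:
  assumes "is_spectrum \<mu> \<Lambda>" "l \<in> \<Lambda>" "k \<in> \<Lambda>" "l \<noteq> k"
  shows "fourier \<mu> (l - k) = 0"
proof -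
  have "(LINT x|\<mu>. expo l x * cnj (expo k x)) = 0"
    using assms unfolding is_spectrum_def by presburger
  then show ?thesis
    by (simp add: fourier_def expo_diff)
qed

section \<open>Averaging over a digit\<close>

lemma integral_pair_mult:
  fixes f :: "'a \<Rightarrow> complex" and g :: "'b \<Rightarrow> complex"
  assumes "prob_space M" "prob_space N"
    and [measurable]: "f \<in> borel_measurable M" "g \<in> borel_measurable N"
    and bd: "\<And>x. cmod (f x) \<le> C" "\<And>y. cmod (g y) \<le> C"
  shows "(LINT z|(M \<Otimes>\<^sub>M N). f (fst z) * g (snd z)) = (LINT x|M. f x) * (LINT y|N. g y)"
proof -
  interpret M: prob_space M by fact
  interpret N: prob_space N by fact
  interpret pair_prob_space M N ..
  have "integrable (M \<Otimes>\<^sub>M N) (\<lambda>z. f (fst z) * g (snd z))"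
    using bd by (intro P.integrable_bounded_by[where C = "C * C"]) (auto simp: norm_mult intro!: mult_mono')
  then show ?thesis
    by (subst integral_fst'[symmetric]) auto
qed

lemma expectation_uniform:
  fixes f :: "'a \<Rightarrow> complex"
  assumes "finite D"
  shows "(LINT d|uniform_count_measure D. f d) = (\<Sum>d\<in>D. f d) / of_nat (card D)"
  using assms by (simp add: uniform_count_measure_def lebesgue_integral_point_measure_finite
      scaleR_conv_of_real sum_divide_distrib)

text \<open>
  Bessel's inequality for vectors of the form \<open>(d, x) \<mapsto> u k d * expo (\<eta> k) x\<close> in the space of
  square integrable functions on \<open>D \<times> \<real>\<^sup>2\<close>, tested against a product of two characters. The digit
  parts \<open>u k\<close> are arbitrary functions, not only characters: this freedom is what the exchange argument
  exploits.
\<close>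

lemma tensor_bessel:
  fixes u :: "'k \<Rightarrow> real ^ 2 \<Rightarrow> complex"
  assumes "prob_space \<nu>" "sets \<nu> = sets borel" "finite D" "D \<noteq> {}" "finite K"
    and on: "\<And>k l. k \<in> K \<Longrightarrow> l \<in> K \<Longrightarrow>
       (\<Sum>d\<in>D. u k d * cnj (u l d)) / of_nat (card D) * fourier \<nu> (\<eta> k - \<eta> l) = (if k = l then 1 else 0)"
  shows "(\<Sum>k\<in>K. (cmod ((\<Sum>d\<in>D. expo \<zeta> d * cnj (u k d)) / of_nat (card D)))\<^sup>2
      * (cmod (fourier \<nu> (\<xi> - \<eta> k)))\<^sup>2) \<le> 1"
proof -
  let ?U = "uniform_count_measure D"
  interpret U: prob_space ?U
    using assms by (intro prob_space_uniform_count_measure)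
  interpret N: prob_space \<nu> by fact
  interpret pair_prob_space ?U \<nu> ..
  have [measurable_cong]: "sets \<nu> = sets borel" by fact
  have [measurable]: "f \<in> borel_measurable ?U" for f :: "real ^ 2 \<Rightarrow> complex"
    by (auto simp: measurable_def sets_uniform_count_measure space_uniform_count_measure)
  obtain C where C: "\<And>k d. k \<in> K \<Longrightarrow> d \<in> D \<Longrightarrow> cmod (u k d) \<le> C"
  proof -
    have "bdd_above ((\<lambda>(k, d). cmod (u k d)) ` (K \<times> D))"
      using assms by (intro bdd_above_finite) auto
    then obtain C where "\<And>x. x \<in> (\<lambda>(k, d). cmod (u k d)) ` (K \<times> D) \<Longrightarrow> x \<le> C"
      unfolding bdd_above_def by blast
    then show thesis
      by (intro that[of C]) force
  qed
  define v where "v k d = (if d \<in> D then u k d else 0)" for k d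
  have v: "cmod (v k d) \<le> max C 1" if "k \<in> K" for k d
    using C[OF that] by (auto simp: v_def le_max_iff_disj)
  define e where "e k z = v k (fst z) * expo (\<eta> k) (snd z)" for k z
  define f where "f z = expo \<zeta> (fst z) * expo \<xi> (snd z)" for z
  have sep: "(LINT z|(?U \<Otimes>\<^sub>M \<nu>). (g (fst z) * expo a (snd z)) * cnj (h (fst z) * expo b (snd z))) =
     (\<Sum>d\<in>D. g d * cnj (h d)) / of_nat (card D) * fourier \<nu> (a - b)"
    if "\<And>d. cmod (g d) \<le> B" "\<And>d. cmod (h d) \<le> B" for g h a b B
  proof -
    have "0 \<le> B" using that(1) norm_ge_zero order_trans by blast
    have *: "cmod (g d * cnj (h d)) \<le> max (B * B) 1" for d
      using that \<open>0 \<le> B\<close> by (auto simp: norm_mult le_max_iff_disj intro!: disjI1 mult_mono')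
    have "(LINT z|(?U \<Otimes>\<^sub>M \<nu>). (g (fst z) * expo a (snd z)) * cnj (h (fst z) * expo b (snd z))) =
       (LINT z|(?U \<Otimes>\<^sub>M \<nu>). (\<lambda>d. g d * cnj (h d)) (fst z) * expo (a - b) (snd z))"
      by (simp add: expo_diff mult_ac)
    also have "\<dots> = (LINT d|?U. g d * cnj (h d)) * (LINT y|\<nu>. expo (a - b) y)"
      using * by (intro integral_pair_mult[where C = "max (B * B) 1"] assms U.prob_space_axioms) auto
    finally show ?thesis
      using assms by (simp add: expectation_uniform fourier_def)
  qed
  have "(\<Sum>k\<in>K. (cmod (LINT z|(?U \<Otimes>\<^sub>M \<nu>). f z * cnj (e k z)))\<^sup>2) \<le> (LINT z|(?U \<Otimes>\<^sub>M \<nu>). (cmod (f z))\<^sup>2)"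
  proof (rule P.bessel_inequality[where C = "max C 1"])
    show "(LINT z|(?U \<Otimes>\<^sub>M \<nu>). e k z * cnj (e l z)) = (if k = l then 1 else 0)" if "k \<in> K" "l \<in> K" for k l
      unfolding e_def using sep[of "v k" "max C 1" "v l" "\<eta> k" "\<eta> l"] v that on[OF that] by (simp add: v_def)
  qed (auto simp: e_def f_def norm_mult v assms)
  moreover have "(LINT z|(?U \<Otimes>\<^sub>M \<nu>). f z * cnj (e k z)) =
      (\<Sum>d\<in>D. expo \<zeta> d * cnj (u k d)) / of_nat (card D) * fourier \<nu> (\<xi> - \<eta> k)" if "k \<in> K" for k
    unfolding f_def e_def using sep[of "expo \<zeta>" "max C 1" "v k" \<xi> "\<eta> k"] v[OF that] by (simp add: v_def)
  ultimately show ?thesis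
    by (simp add: f_def norm_mult norm_divide P.prob_space power_mult_distrib power_divide)
qed

text \<open>
  The law of \<open>A (x + d)\<close> when \<open>x\<close> is distributed according to \<open>\<nu>\<close> and \<open>d\<close> is an independent,
  uniformly distributed digit. A self-affine measure is a fixed point of this operation.
\<close>

definition digit_average :: "(real ^ 2) set \<Rightarrow> (real ^ 2 \<Rightarrow> real ^ 2) \<Rightarrow> (real ^ 2) measure \<Rightarrow> (real ^ 2) measure" where
  "digit_average D A \<nu> = distr (uniform_count_measure D \<Otimes>\<^sub>M \<nu>) borel (\<lambda>(d, x). A (x + d))"

lemma sets_digit_average: "sets (digit_average D A \<nu>) = sets borel"
  by (simp add: digit_average_def)

context
  fixes D :: "(real ^ 2) set" and A :: "real ^ 2 \<Rightarrow> real ^ 2" and \<nu> :: "(real ^ 2) measure"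
  assumes D: "finite D" "D \<noteq> {}" and A [measurable]: "A \<in> borel_measurable borel"
    and \<nu>: "prob_space \<nu>" "sets \<nu> = sets borel"
begin

lemma measurable_digit_shift:
  "(\<lambda>(d, x). A (x + d)) \<in> borel_measurable (uniform_count_measure D \<Otimes>\<^sub>M \<nu>)"
proof -
  have [measurable_cong]: "sets \<nu> = sets borel" by (rule \<nu>)
  have [measurable]: "(\<lambda>x. x) \<in> uniform_count_measure D \<rightarrow>\<^sub>M borel"
    by (auto simp: measurable_def sets_uniform_count_measure space_uniform_count_measure)
  show ?thesis by measurable
qed

lemma prob_space_digit_average: "prob_space (digit_average D A \<nu>)"
proof -
  interpret U: prob_space "uniform_count_measure D"
    using D by (intro prob_space_uniform_count_measure)
  interpret N: prob_space \<nu> by (rule \<nu>)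
  interpret pair_prob_space "uniform_count_measure D" \<nu> ..
  show ?thesis
    unfolding digit_average_def by (rule P.prob_space_distr[OF measurable_digit_shift])
qed

lemma fourier_digit_average:
  assumes adj: "\<And>x. expo \<xi> (A x) = expo \<zeta> x"
  shows "fourier (digit_average D A \<nu>) \<xi> = mask D \<zeta> * fourier \<nu> \<zeta>"
proof -
  interpret U: prob_space "uniform_count_measure D"
    using D by (intro prob_space_uniform_count_measure)
  interpret N: prob_space \<nu> by (rule \<nu>)
  have [measurable_cong]: "sets \<nu> = sets borel" by (rule \<nu>)
  have [measurable]: "f \<in> borel_measurable (uniform_count_measure D)" for f :: "real ^ 2 \<Rightarrow> complex"
    by (auto simp: measurable_def sets_uniform_count_measure space_uniform_count_measure)
  have "fourier (digit_average D A \<nu>) \<xi> =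
      (LINT z|(uniform_count_measure D \<Otimes>\<^sub>M \<nu>). expo \<xi> ((\<lambda>(d, x). A (x + d)) z))"
    unfolding fourier_def digit_average_def using measurable_digit_shift by (intro integral_distr) auto
  also have "\<dots> = (LINT z|(uniform_count_measure D \<Otimes>\<^sub>M \<nu>). expo \<zeta> (fst z) * expo \<zeta> (snd z))"
    by (simp add: adj expo_add_point case_prod_beta mult.commute)
  also have "\<dots> = (LINT d|uniform_count_measure D. expo \<zeta> d) * (LINT y|\<nu>. expo \<zeta> y)"
    by (intro integral_pair_mult[where C = 1] U.prob_space_axioms \<nu>) auto
  finally show ?thesis
    using D by (simp add: expectation_uniform mask_def fourier_def)
qed

lemma measure_digit_average:
  assumes "X \<in> sets borel"
  shows "measure (digit_average D A \<nu>) X = (\<Sum>d\<in>D. measure (distr \<nu> borel (\<lambda>x. A (x + d))) X) / card D"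
proof -
  interpret U: prob_space "uniform_count_measure D"
    using D by (intro prob_space_uniform_count_measure)
  interpret N: prob_space \<nu> by (rule \<nu>)
  interpret pair_prob_space "uniform_count_measure D" \<nu> ..
  have [measurable_cong]: "sets \<nu> = sets borel" by (rule \<nu>)
  let ?T = "\<lambda>(d, x). A (x + d)"
  let ?S = "?T -` X \<inter> space (uniform_count_measure D \<Otimes>\<^sub>M \<nu>)"
  have S: "?S \<in> sets (uniform_count_measure D \<Otimes>\<^sub>M \<nu>)"
    using measurable_digit_shift assms by (rule measurable_sets)
  have slice: "measure (distr \<nu> borel (\<lambda>x. A (x + d))) X = measure \<nu> (Pair d -` ?S)" if "d \<in> D" for d
    using that assms by (subst measure_distr)
      (auto simp: space_pair_measure space_uniform_count_measure intro!: arg_cong[of _ _ "measure \<nu>"])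
  have "measure (digit_average D A \<nu>) X = measure (uniform_count_measure D \<Otimes>\<^sub>M \<nu>) ?S"
    unfolding digit_average_def by (rule measure_distr[OF measurable_digit_shift assms])
  also have "\<dots> = (LINT z|(uniform_count_measure D \<Otimes>\<^sub>M \<nu>). indicator ?S z)"
    using sets.sets_into_space[OF S] by (simp add: Int_absorb2)
  also have "\<dots> = (LINT d|uniform_count_measure D. LINT x|\<nu>. indicator ?S (d, x))"
    using S by (intro integral_fst'[symmetric] P.integrable_const_bound[where B = 1]) auto
  also have "\<dots> = (LINT d|uniform_count_measure D. measure \<nu> (Pair d -` ?S))"
  proof (rule Bochner_Integration.integral_cong[OF refl])
    fix d
    have "(LINT x|\<nu>. indicator ?S (d, x)) = (LINT x|\<nu>. indicator (Pair d -` ?S) x :: real)"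
      by (intro Bochner_Integration.integral_cong refl) (simp add: indicator_def)
    also have "\<dots> = measure \<nu> (Pair d -` ?S)"
      using sets.sets_into_space[OF sets_Pair1[OF S, of d]] by (simp add: Int_absorb2)
    finally show "(LINT x|\<nu>. indicator ?S (d, x)) = measure \<nu> (Pair d -` ?S)" .
  qed
  also have "\<dots> = (\<Sum>d\<in>D. measure \<nu> (Pair d -` ?S)) / card D"
    using D by (simp add: integral_uniform_count_measure)
  finally show ?thesis
    by (simp add: slice)
qed

end

section \<open>Exchanging vectors in an orthonormal basis of exponentials\<close>

text \<open>
  Here \<open>\<mu>\<close> behaves like the convolution of \<open>\<nu>\<close> with a linear image of the uniform measure on \<open>D\<close>, where
  \<open>B\<close> is the adjoint of that linear map. Only the factorization of the Fourier transform is recorded, since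
  all inner products of exponentials are values of it.
\<close>

locale digit_factor =
  fixes D :: "(real ^ 2) set" and B :: "real ^ 2 \<Rightarrow> real ^ 2"
    and \<mu> \<nu> :: "(real ^ 2) measure" and \<Lambda> :: "(real ^ 2) set"
  assumes D: "finite D" "D \<noteq> {}"
    and \<mu>: "prob_space \<mu>" "sets \<mu> = sets borel"
    and \<nu>: "prob_space \<nu>" "sets \<nu> = sets borel"
    and spectrum: "is_spectrum \<mu> \<Lambda>"
    and B_diff: "\<And>x y. B (x - y) = B x - B y"
    and factor: "\<And>\<xi>. fourier \<mu> \<xi> = mask D (B \<xi>) * fourier \<nu> \<xi>"
begin

text \<open>
  Two exponentials of \<open>\<Lambda>\<close> are orthogonal in \<open>L^2(\<mu>)\<close> because their digit parts or their \<open>\<nu>\<close> parts are.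
  So the product vectors \<open>expo (B l) \<otimes> expo l\<close> stay orthonormal when the ones with \<open>l \<in> E\<close> are removed and
  the single vector \<open>w \<otimes> expo l0\<close> is inserted. By Bessel's inequality the contribution of the new vector
  is at most what the removed ones leave free, and by Parseval's identity for \<open>\<Lambda>\<close> this is exactly
  the contribution that they had.
\<close>

lemma exchange:
  assumes E: "l0 \<in> E" "finite E" "E \<subseteq> \<Lambda>"
    and w: "(\<Sum>d\<in>D. w d * cnj (w d)) / of_nat (card D) = 1"
    and orth: "\<And>l. l \<in> \<Lambda> - E \<Longrightarrow> fourier \<nu> (l - l0) = 0 \<or> (\<Sum>d\<in>D. expo (B l) d * cnj (w d)) = 0"
  shows "(cmod ((\<Sum>d\<in>D. expo (B \<xi>) d * cnj (w d)) / of_nat (card D)))\<^sup>2 * (cmod (fourier \<nu> (\<xi> - l0)))\<^sup>2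
    \<le> (\<Sum>l\<in>E. (cmod (fourier \<mu> (\<xi> - l)))\<^sup>2)" (is "?Q \<le> ?R")
proof (rule field_le_epsilon)
  fix \<epsilon> :: real assume "\<epsilon> > 0"
  then obtain F where F: "finite F" "F \<subseteq> \<Lambda>"
    and big: "(\<Sum>l\<in>F. (cmod (fourier \<mu> (\<xi> - l)))\<^sup>2) > 1 - \<epsilon>"
    using spectrum_almost_parseval[OF \<mu> spectrum] by blast
  define u where "u l = (if l = l0 then w else expo (B l))" for l
  have orth': "(\<Sum>d\<in>D. w d * cnj (expo (B l) d)) = 0" if "l \<in> F - E" "fourier \<nu> (l - l0) \<noteq> 0" for l
  proof -
    have "(\<Sum>d\<in>D. expo (B l) d * cnj (w d)) = 0"
      using orth[of l] that F by auto
    then have "cnj (\<Sum>d\<in>D. expo (B l) d * cnj (w d)) = 0"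
      by (simp only: complex_cnj_zero)
    then show ?thesis
      by (simp add: mult.commute)
  qed
  have nu_sym: "fourier \<nu> (l0 - l) = cnj (fourier \<nu> (l - l0))" for l
    using fourier_minus[of \<nu> "l - l0"] by simp
  have "(\<Sum>l\<in>insert l0 (F - E). (cmod ((\<Sum>d\<in>D. expo (B \<xi>) d * cnj (u l d)) / of_nat (card D)))\<^sup>2
      * (cmod (fourier \<nu> (\<xi> - l)))\<^sup>2) \<le> 1"
  proof (rule tensor_bessel[OF \<nu> D])
    fix k l assume kl: "k \<in> insert l0 (F - E)" "l \<in> insert l0 (F - E)"
    consider "k = l0" "l = l0" | "k = l0" "l \<in> F - E" "l \<noteq> l0" | "l = l0" "k \<in> F - E" "k \<noteq> l0"
      | "l \<in> F - E" "k \<in> F - E" "l \<noteq> l0" "k \<noteq> l0"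
      using kl by blast
    then show "(\<Sum>d\<in>D. u k d * cnj (u l d)) / of_nat (card D) * fourier \<nu> (k - l) = (if k = l then 1 else 0)"
    proof cases
      case 1
      then show ?thesis using w by (simp add: u_def fourier_0[OF \<nu>(1)])
    next
      case 2
      then show ?thesis using orth'[of l] by (auto simp: u_def nu_sym)
    next
      case 3
      then show ?thesis using orth[of k] F by (auto simp: u_def)
    next
      case 4
      then have "(\<Sum>d\<in>D. u k d * cnj (u l d)) / of_nat (card D) * fourier \<nu> (k - l) = fourier \<mu> (k - l)"
        by (simp add: u_def mean_expo factor B_diff)
      also have "\<dots> = (if k = l then 1 else 0)"
        using spectrum_orthogonal[OF spectrum, of k l] 4 F by (auto simp: fourier_0[OF \<mu>(1)])
      finally show ?thesis .
    qed
  qed (use F in auto)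
  moreover have "(\<Sum>l\<in>F - E. (cmod ((\<Sum>d\<in>D. expo (B \<xi>) d * cnj (u l d)) / of_nat (card D)))\<^sup>2
      * (cmod (fourier \<nu> (\<xi> - l)))\<^sup>2) = (\<Sum>l\<in>F - E. (cmod (fourier \<mu> (\<xi> - l)))\<^sup>2)"
  proof (rule sum.cong[OF refl])
    fix l assume "l \<in> F - E"
    then have "u l = expo (B l)" using E by (auto simp: u_def)
    then show "(cmod ((\<Sum>d\<in>D. expo (B \<xi>) d * cnj (u l d)) / of_nat (card D)))\<^sup>2
      * (cmod (fourier \<nu> (\<xi> - l)))\<^sup>2 = (cmod (fourier \<mu> (\<xi> - l)))\<^sup>2"
      by (simp add: mean_expo factor B_diff norm_mult power_mult_distrib)
  qed
  ultimately have 1: "?Q + (\<Sum>l\<in>F - E. (cmod (fourier \<mu> (\<xi> - l)))\<^sup>2) \<le> 1"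
    using E F by (simp add: u_def)
  have "(\<Sum>l\<in>F. (cmod (fourier \<mu> (\<xi> - l)))\<^sup>2) \<le> (\<Sum>l\<in>(F - E) \<union> E. (cmod (fourier \<mu> (\<xi> - l)))\<^sup>2)"
    using E F by (intro sum_mono2) auto
  also have "\<dots> = (\<Sum>l\<in>F - E. (cmod (fourier \<mu> (\<xi> - l)))\<^sup>2) + ?R"
    using E F by (intro sum.union_disjoint) auto
  finally show "?Q \<le> ?R + \<epsilon>"
    using 1 big by simp
qed

text \<open>
  If no frequency is separated from \<open>l0\<close> by the distinguished digit, then the digit part at \<open>l0\<close> may be
  exchanged for any unit vector; the best choice is the character \<open>expo (B \<xi>)\<close> against which the family
  is tested, so \<open>w\<close> depends on \<open>\<xi>\<close>.
\<close>

lemma isolated_frequency: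
  assumes "l0 \<in> \<Lambda>" "\<And>l. l \<in> \<Lambda> \<Longrightarrow> mask D (B (l - l0)) \<noteq> 0"
  shows "cmod (fourier \<nu> \<zeta>) \<le> cmod (mask D (B \<zeta>)) * cmod (fourier \<nu> \<zeta>)"
proof -
  let ?\<xi> = "\<zeta> + l0"
  have "fourier \<nu> (l - l0) = 0" if "l \<in> \<Lambda> - {l0}" for l
    using spectrum_orthogonal[OF spectrum, of l l0] assms that by (auto simp: factor)
  moreover have "(\<Sum>d\<in>D. expo (B ?\<xi>) d * cnj (expo (B ?\<xi>) d)) / of_nat (card D) = 1"
    using D by (simp add: mean_expo)
  ultimately have "(cmod (fourier \<nu> (?\<xi> - l0)))\<^sup>2 \<le> (cmod (fourier \<mu> (?\<xi> - l0)))\<^sup>2"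
    using exchange[of l0 "{l0}" "expo (B ?\<xi>)" ?\<xi>] assms(1) by simp
  then have "(cmod (fourier \<nu> \<zeta>))\<^sup>2 \<le> (cmod (mask D (B \<zeta>)) * cmod (fourier \<nu> \<zeta>))\<^sup>2"
    by (simp add: factor norm_mult)
  then show ?thesis
    by (rule power2_le_imp_le) simp
qed

text \<open>
  The hypothesis says that a frequency which the digit separates from \<open>l0\<close> is also separated from its twin
  \<open>l1\<close>. Then \<open>l0\<close> and \<open>l1\<close> may be exchanged for one vector whose digit part lies in the plane
  spanned by their two digit characters.
\<close>

lemma twin_frequencies:
  assumes "l0 \<in> \<Lambda>" "l1 \<in> \<Lambda>" and twin: "mask D (B (l0 - l1)) = 0"
    and tr: "\<And>l. l \<in> \<Lambda> - {l0, l1} \<Longrightarrow> mask D (B (l - l0)) = 0 \<Longrightarrow> mask D (B (l - l1)) = 0"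
    and nz: "mask D (B (\<xi> - l1)) \<noteq> 0"
  shows "cmod (fourier \<nu> (\<xi> - l0)) \<le> cmod (fourier \<nu> (\<xi> - l1))"
proof -
  have B0: "B 0 = 0" using B_diff[of 0 0] by simp
  have ne: "l0 \<noteq> l1"
    using twin mask_0[OF D] B_diff[of l1 l1] by auto
  have twin': "mask D (B (l1 - l0)) = 0"
    using twin mask_minus[of D "B (l0 - l1)"] by (simp add: B_diff)
  let ?n = "of_nat (card D) :: complex"
  define \<alpha> where "\<alpha> = mask D (B (\<xi> - l0))"
  define \<beta> where "\<beta> = mask D (B (\<xi> - l1))"
  define s where "s = sqrt ((cmod \<alpha>)\<^sup>2 + (cmod \<beta>)\<^sup>2)"
  have "(cmod \<alpha>)\<^sup>2 + (cmod \<beta>)\<^sup>2 > 0"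
    using nz by (simp add: \<beta>_def add_nonneg_pos)
  then have s: "s > 0" "s\<^sup>2 = (cmod \<alpha>)\<^sup>2 + (cmod \<beta>)\<^sup>2"
    by (simp_all add: s_def)
  have ss: "complex_of_real s * complex_of_real s = \<alpha> * cnj \<alpha> + \<beta> * cnj \<beta>"
    using s(2) by (metis complex_norm_square of_real_add of_real_mult power2_eq_square)
  \<comment> \<open>The normalized projection of the test character onto the plane of the two digit characters;
    its inner product with the test character is \<open>s\<close>.\<close>
  define w where "w d = (\<alpha> * expo (B l0) d + \<beta> * expo (B l1) d) / of_real s" for d
  have mean_w: "(\<Sum>d\<in>D. expo (B x) d * cnj (w d)) / ?n =
      (cnj \<alpha> * mask D (B (x - l0)) + cnj \<beta> * mask D (B (x - l1))) / of_real s" for x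
  proof -
    have "(\<Sum>d\<in>D. expo (B x) d * cnj (w d)) = (cnj \<alpha> * (\<Sum>d\<in>D. expo (B x) d * cnj (expo (B l0) d))
        + cnj \<beta> * (\<Sum>d\<in>D. expo (B x) d * cnj (expo (B l1) d))) / of_real s"
      by (simp add: w_def add_divide_distrib distrib_left sum.distrib sum_distrib_left sum_divide_distrib mult_ac)
    then show ?thesis
      unfolding B_diff mean_expo[symmetric] by (simp add: add_divide_distrib mult_ac)
  qed
  have "(\<Sum>d\<in>D. w d * cnj (w d)) / ?n = (\<alpha> * ((\<Sum>d\<in>D. expo (B l0) d * cnj (w d)) / ?n)
      + \<beta> * ((\<Sum>d\<in>D. expo (B l1) d * cnj (w d)) / ?n)) / of_real s"
  proof -
    have "w d * cnj (w d) = (\<alpha> * (expo (B l0) d * cnj (w d)) + \<beta> * (expo (B l1) d * cnj (w d))) / of_real s" for d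
      by (subst (1) w_def) (simp add: add_divide_distrib distrib_left distrib_right mult_ac)
    then show ?thesis
      by (simp add: add_divide_distrib sum.distrib sum_distrib_left sum_divide_distrib mult_ac)
  qed
  also have "\<dots> = (\<alpha> * cnj \<alpha> + \<beta> * cnj \<beta>) / (of_real s * of_real s)"
    unfolding mean_w using D s by (simp add: B0 twin twin' field_simps)
  also have "\<dots> = 1"
    using s unfolding ss[symmetric] by simp
  finally have w1: "(\<Sum>d\<in>D. w d * cnj (w d)) / ?n = 1" .
  have orth: "fourier \<nu> (l - l0) = 0 \<or> (\<Sum>d\<in>D. expo (B l) d * cnj (w d)) = 0"
    if l: "l \<in> \<Lambda> - {l0, l1}" for l
  proof (cases "mask D (B (l - l0)) = 0")
    case True
    then have "(\<Sum>d\<in>D. expo (B l) d * cnj (w d)) / ?n = 0"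
      using tr[OF l] by (simp add: mean_w)
    then show ?thesis using D by simp
  next
    case False
    then show ?thesis
      using spectrum_orthogonal[OF spectrum, of l l0] assms l by (auto simp: factor)
  qed
  have "(\<Sum>d\<in>D. expo (B \<xi>) d * cnj (w d)) / ?n = (\<alpha> * cnj \<alpha> + \<beta> * cnj \<beta>) / of_real s"
    unfolding mean_w by (simp add: \<alpha>_def \<beta>_def mult.commute)
  also have "\<dots> = of_real s"
    using s unfolding ss[symmetric] by simp
  finally have "s\<^sup>2 * (cmod (fourier \<nu> (\<xi> - l0)))\<^sup>2
      \<le> (cmod (fourier \<mu> (\<xi> - l0)))\<^sup>2 + (cmod (fourier \<mu> (\<xi> - l1)))\<^sup>2"
    using exchange[of l0 "{l0, l1}" w \<xi>, OF _ _ _ w1 orth] assms(1,2) ne by simp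
  then have "(cmod \<beta>)\<^sup>2 * (cmod (fourier \<nu> (\<xi> - l0)))\<^sup>2 \<le> (cmod \<beta>)\<^sup>2 * (cmod (fourier \<nu> (\<xi> - l1)))\<^sup>2"
    unfolding s(2) by (simp add: factor norm_mult power_mult_distrib algebra_simps flip: \<alpha>_def \<beta>_def)
  then have "(cmod (fourier \<nu> (\<xi> - l0)))\<^sup>2 \<le> (cmod (fourier \<nu> (\<xi> - l1)))\<^sup>2"
    using nz by (simp add: \<beta>_def)
  then show ?thesis
    by (rule power2_le_imp_le) simp
qed

end

section \<open>Lower triangular maps with a common eigenbasis\<close>

text \<open>
  The linear map with eigenvector \<open>(1, \<gamma>)\<close> for the eigenvalue \<open>x\<close> and \<open>(0, 1)\<close> for \<open>y\<close>. For the slope \<open>\<gamma>\<close>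
  of \<open>M\<close>, all powers of the transpose of \<open>M\<close>, negative ones included, have this form.
\<close>

definition shear :: "real \<Rightarrow> real \<Rightarrow> real \<Rightarrow> real ^ 2 \<Rightarrow> real ^ 2" where
  "shear \<gamma> x y \<xi> = vector [x * \<xi> $ 1, \<gamma> * (x - y) * \<xi> $ 1 + y * \<xi> $ 2]"

lemma shear_components [simp]:
  "shear \<gamma> x y \<xi> $ 1 = x * \<xi> $ 1"
  "shear \<gamma> x y \<xi> $ 2 = \<gamma> * (x - y) * \<xi> $ 1 + y * \<xi> $ 2"
  by (simp_all add: shear_def)

lemma shear_shear: "shear \<gamma> x y (shear \<gamma> x' y' \<xi>) = shear \<gamma> (x * x') (y * y') \<xi>"
  by (simp add: vec_eq_iff forall_2 algebra_simps)

lemma shear_diff: "shear \<gamma> x y (\<xi> - \<eta>) = shear \<gamma> x y \<xi> - shear \<gamma> x y \<eta>"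
  by (simp add: vec_eq_iff forall_2 algebra_simps)

lemma shear_0: "shear \<gamma> x y 0 = 0"
  by (simp add: vec_eq_iff forall_2)

lemma shear_1_1 [simp]: "shear \<gamma> 1 1 \<xi> = \<xi>"
  by (simp add: vec_eq_iff forall_2)

lemma tendsto_vec2:
  fixes X :: "nat \<Rightarrow> real ^ 2"
  assumes "(\<lambda>n. X n $ 1) \<longlonglongrightarrow> x $ 1" "(\<lambda>n. X n $ 2) \<longlonglongrightarrow> x $ 2"
  shows "X \<longlonglongrightarrow> x"
  using assms by (intro vec_tendstoI) (use forall_2[of "\<lambda>i. (\<lambda>n. X n $ i) \<longlonglongrightarrow> x $ i"] in blast)

lemma tendsto_shear:
  assumes "X \<longlonglongrightarrow> x" shows "(\<lambda>n. shear \<gamma> u v (X n)) \<longlonglongrightarrow> shear \<gamma> u v x"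
  by (rule tendsto_vec2; unfold shear_components; intro tendsto_intros assms)

lemma prime_power_balance:
  fixes q A P Q :: int
  assumes "prime q" "q dvd A" "A \<noteq> 0" "\<not> q dvd P" "\<not> q dvd Q" "A ^ m * P = A ^ n * Q"
  shows "m = n"
proof -
  have *: False if "m < n" "\<not> q dvd P" "A ^ m * P = A ^ n * Q" for m n P Q
  proof -
    have "A ^ n = A ^ m * (A * A ^ (n - m - 1))"
      using that(1) by (simp flip: power_Suc power_add)
    then have "P = A * A ^ (n - m - 1) * Q"
      using that(3) assms(3) by (simp add: mult.assoc)
    then show False
      using that(2) assms(2) by simp
  qed
  show ?thesis
    using *[of m n P Q] *[of n m Q P] assms by (metis linorder_neqE_nat)
qed

text \<open>
  Rationality of the two images gives two linear equations with rational coefficients for the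
  numbers \<open>\<beta>\<close> and \<open>C = \<gamma> * (\<alpha> - \<beta>)\<close>. If they determine these numbers, both are rational and so is \<open>\<gamma>\<close>;
  otherwise \<open>y\<close> is an eigenvector for \<open>\<alpha>\<close>, and its rational slope is \<open>\<gamma>\<close>.
\<close>

lemma rational_orbit_imp_rational_slope:
  assumes "\<alpha> \<in> \<rat>" "\<alpha> \<noteq> \<beta>" "y $ 1 \<in> \<rat>" "y $ 2 \<in> \<rat>" "y $ 1 \<noteq> 0"
    and r1: "shear \<gamma> \<alpha> \<beta> y $ 2 \<in> \<rat>"
    and r2: "shear \<gamma> (\<alpha> * \<alpha>) (\<beta> * \<beta>) y $ 2 \<in> \<rat>"
  shows "\<gamma> \<in> \<rat>"
proof -
  let ?y1 = "y $ 1" and ?y2 = "y $ 2"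
  define C where "C = \<gamma> * (\<alpha> - \<beta>)"
  define r where "r = C * ?y1 + \<beta> * ?y2"
  define t where "t = C * \<alpha> * ?y1 + \<beta> * r"
  have r: "r \<in> \<rat>" using r1 by (simp add: r_def C_def)
  have t: "t \<in> \<rat>" using r2 by (simp add: t_def r_def C_def algebra_simps)
  have \<gamma>: "\<gamma> = C / (\<alpha> - \<beta>)" using assms(2) by (simp add: C_def)
  show ?thesis
  proof (cases "r = \<alpha> * ?y2")
    case True
    then have "(\<gamma> * ?y1) * (\<alpha> - \<beta>) = ?y2 * (\<alpha> - \<beta>)"
      by (simp add: r_def C_def algebra_simps)
    then have "\<gamma> * ?y1 = ?y2"
      using assms(2) mult_right_cancel[of "\<alpha> - \<beta>" "\<gamma> * ?y1" ?y2] by simp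
    then have "\<gamma> = ?y2 / ?y1"
      using assms(5) by (simp add: field_simps)
    then show ?thesis using assms by simp
  next
    case False
    have "\<beta> * (r - \<alpha> * ?y2) = t - \<alpha> * r"
      by (simp add: t_def r_def algebra_simps)
    then have "\<beta> = (t - \<alpha> * r) / (r - \<alpha> * ?y2)"
      using False by (simp add: field_simps)
    then have \<beta>: "\<beta> \<in> \<rat>" using r t assms by simp
    have "C = (r - \<beta> * ?y2) / ?y1"
      using assms(5) by (simp add: r_def)
    then have "C \<in> \<rat>" using r \<beta> assms by simp
    then show ?thesis unfolding \<gamma> using \<beta> assms by simp
  qed
qed

section \<open>Levels of differences in a spectrum\<close>

text \<open>
  What the argument uses about a self-affine measure with a spectrum: the shape of the zeros of
  the digit mask, the functional equation of the Fourier transform, and for each \<open>n\<close> a probability measure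
  whose transform is the product with the \<open>n\<close>-th mask factor left out. For the first digit this measure is
  known more precisely as a contracted copy of \<open>\<mu>\<close>.
\<close>

locale triangular_spectral_system =
  fixes p :: nat and D :: "(real ^ 2) set" and d11 \<gamma> \<rho>1 \<rho>2 :: real
    and \<mu> :: "(real ^ 2) measure" and \<Lambda> :: "(real ^ 2) set"
  assumes p: "prime p"
    and D: "finite D" "0 \<in> D" "vector [d11, 0] \<in> D" "d11 \<noteq> 0"
    and \<rho>: "0 < \<rho>1" "\<rho>1 < 1" "0 < \<rho>2" "\<rho>2 < 1" "\<rho>1 \<noteq> \<rho>2"
    and zero_fst: "\<And>x. mask D x = 0 \<Longrightarrow> \<exists>v::int. real p * x $ 1 = of_int v \<and> \<not> int p dvd v"
    and zero_snd: "\<And>x. mask D x = 0 \<Longrightarrow> real p * x $ 2 \<in> \<int>"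
    and zero_add: "\<And>x y. mask D x = 0 \<Longrightarrow> mask D y = 0 \<Longrightarrow> mask D (x + y) = 0 \<or> x + y \<in> int_lattice"
    and \<mu>: "prob_space \<mu>" "sets \<mu> = sets borel"
    and spectrum: "is_spectrum \<mu> \<Lambda>"
    and fourier_step: "\<And>\<xi>. fourier \<mu> \<xi> = mask D (shear \<gamma> \<rho>1 \<rho>2 \<xi>) * fourier \<mu> (shear \<gamma> \<rho>1 \<rho>2 \<xi>)"
    and omit_digit: "\<And>n. \<exists>\<nu>. prob_space \<nu> \<and> sets \<nu> = sets borel \<and>
       (\<forall>\<xi>. fourier \<mu> \<xi> = mask D (shear \<gamma> (\<rho>1 ^ Suc n) (\<rho>2 ^ Suc n) \<xi>) * fourier \<nu> \<xi>)"
    and omit_first: "\<exists>\<nu>. prob_space \<nu> \<and> sets \<nu> = sets borel \<and>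
       (\<forall>\<xi>. fourier \<nu> \<xi> = fourier \<mu> (shear \<gamma> \<rho>1 \<rho>2 \<xi>))"
begin

definition contract :: "nat \<Rightarrow> real ^ 2 \<Rightarrow> real ^ 2" where
  "contract n = shear \<gamma> (\<rho>1 ^ n) (\<rho>2 ^ n)"

lemma contract_0 [simp]: "contract 0 \<xi> = \<xi>"
  by (simp add: contract_def)

lemma contract_1: "contract 1 = shear \<gamma> \<rho>1 \<rho>2"
  by (simp add: contract_def)

lemma contract_contract: "contract m (contract n \<xi>) = contract (m + n) \<xi>"
  by (simp add: contract_def shear_shear power_add)

lemma contract_fst [simp]: "contract n \<xi> $ 1 = \<rho>1 ^ n * \<xi> $ 1"
  by (simp add: contract_def)

lemma contract_diff: "contract n (\<xi> - \<eta>) = contract n \<xi> - contract n \<eta>"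
  by (simp add: contract_def shear_diff)

lemma contract_surj: obtains \<eta> where "contract n \<eta> = \<xi>"
proof
  show "contract n (shear \<gamma> (inverse \<rho>1 ^ n) (inverse \<rho>2 ^ n) \<xi>) = \<xi>"
    using \<rho> by (simp add: contract_def shear_shear flip: power_mult_distrib)
qed

lemma contract_tendsto_0: "(\<lambda>n. contract n \<xi>) \<longlonglongrightarrow> 0"
proof -
  have l: "(\<lambda>n. \<rho>1 ^ n) \<longlonglongrightarrow> 0" "(\<lambda>n. \<rho>2 ^ n) \<longlonglongrightarrow> 0"
    using \<rho> by (auto intro: LIMSEQ_realpow_zero)
  have "(\<lambda>n. \<rho>1 ^ n * \<xi> $ 1) \<longlonglongrightarrow> 0 * \<xi> $ 1"
    "(\<lambda>n. \<gamma> * (\<rho>1 ^ n - \<rho>2 ^ n) * \<xi> $ 1 + \<rho>2 ^ n * \<xi> $ 2) \<longlonglongrightarrow> \<gamma> * (0 - 0) * \<xi> $ 1 + 0 * \<xi> $ 2"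
    by (intro tendsto_intros l)+
  then show ?thesis
    unfolding contract_def by (intro tendsto_vec2) simp_all
qed

lemma fourier_contract: "fourier \<mu> \<xi> = mask D (contract 1 \<xi>) * fourier \<mu> (contract 1 \<xi>)"
  unfolding contract_1 by (rule fourier_step)

lemma D_ne: "D \<noteq> {}" using D by blast

lemma mask_diff_sym: "mask D (contract n (x - y)) = 0 \<longleftrightarrow> mask D (contract n (y - x)) = 0"
  using mask_minus[of D "contract n (x - y)"] by (simp add: contract_diff)

text \<open>
  If no factor of the infinite product vanishes, then the functional equation carries the zero along the
  orbit of \<open>\<xi>\<close>, which tends to 0, contradicting that the transform is 1 there.
\<close>

lemma fourier_zero_level:
  assumes "fourier \<mu> \<xi> = 0"
  obtains n where "mask D (contract (Suc n) \<xi>) = 0"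
proof (rule ccontr)
  assume "\<not> thesis"
  then have nz: "mask D (contract (Suc n) \<xi>) \<noteq> 0" for n
    using that by blast
  have "fourier \<mu> (contract n \<xi>) = 0" for n
  proof (induction n)
    case (Suc n)
    then show ?case
      using fourier_contract[of "contract n \<xi>"] nz[of n] by (simp add: contract_contract)
  qed (use assms in simp)
  then have "(\<lambda>n. 0) \<longlonglongrightarrow> fourier \<mu> 0"
    using tendsto_fourier[OF \<mu> contract_tendsto_0, of \<xi>] by simp
  then show False
    using fourier_0[OF \<mu>(1)] by (simp add: LIMSEQ_const_iff)
qed

text \<open>
  A null sequence on the first axis. The denominators make its first coordinates, multiplied by \<open>p\<close> or by
  \<open>d11\<close>, smaller than 1 in absolute value, hence not integral.
\<close>

definition axis :: "nat \<Rightarrow> real ^ 2" where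
  "axis n = vector [1 / (real n + 2 + real p + \<bar>d11\<bar>), 0]"

lemma axis_tendsto_0: "axis \<longlonglongrightarrow> 0"
proof (rule tendsto_vec2)
  have "filterlim (\<lambda>n. (2 + real p + \<bar>d11\<bar>) + real n) at_top sequentially"
    by (intro filterlim_tendsto_add_at_top[OF tendsto_const] filterlim_real_sequentially)
  then have "(\<lambda>n. 1 / ((2 + real p + \<bar>d11\<bar>) + real n)) \<longlonglongrightarrow> 0"
    by (intro tendsto_divide_0[OF tendsto_const] filterlim_at_top_imp_at_infinity)
  then show "(\<lambda>n. axis n $ 1) \<longlonglongrightarrow> 0 $ 1"
    by (simp add: axis_def add_ac)
qed (simp add: axis_def)

lemma axis_bounds:
  "0 < axis n $ 1" "real p * axis n $ 1 < 1" "\<bar>d11\<bar> * axis n $ 1 < 1"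
proof -
  have "0 < real n + 2 + real p + \<bar>d11\<bar>"
    using of_nat_0_le_iff[of n, where 'a = real] of_nat_0_le_iff[of p, where 'a = real] by linarith
  then show "0 < axis n $ 1" "real p * axis n $ 1 < 1" "\<bar>d11\<bar> * axis n $ 1 < 1"
    by (auto simp: axis_def divide_less_eq)
qed

lemma Ints_between: "t \<notin> \<int>" if "0 < \<bar>t\<bar>" "\<bar>t\<bar> < (1::real)"
proof
  assume "t \<in> \<int>"
  then obtain n where "t = of_int n" by (rule Ints_cases)
  with that show False by simp
qed

lemma inner_d1: "\<xi> \<bullet> (vector [d11, 0] :: real ^ 2) = \<xi> $ 1 * d11"
  by (simp add: inner_vec_def sum_2)

text \<open>
  Otherwise \<open>l0\<close> is isolated with respect to the digit \<open>n + 1\<close>, and then the mask has modulus at least 1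
  wherever \<open>\<nu>\<close> has nonzero transform, in particular at points of the first axis arbitrarily close to 0.
  There the digit \<open>(d11, 0)\<close> keeps its modulus below 1.
\<close>

lemma every_level_occurs:
  assumes "l0 \<in> \<Lambda>"
  obtains l where "l \<in> \<Lambda>" "mask D (contract (Suc n) (l - l0)) = 0"
proof (rule ccontr)
  assume "\<not> thesis"
  then have nz: "l \<in> \<Lambda> \<Longrightarrow> mask D (contract (Suc n) (l - l0)) \<noteq> 0" for l
    using that by blast
  obtain \<nu> where \<nu>: "prob_space \<nu>" "sets \<nu> = sets borel"
    and fac: "\<And>\<xi>. fourier \<mu> \<xi> = mask D (contract (Suc n) \<xi>) * fourier \<nu> \<xi>"
    using omit_digit[of n] unfolding contract_def by blast
  interpret F: digit_factor D "contract (Suc n)" \<mu> \<nu> \<Lambda>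
    by (rule digit_factor.intro[OF D(1) D_ne \<mu> \<nu> spectrum contract_diff fac])
  define \<zeta> where "\<zeta> k = shear \<gamma> (inverse \<rho>1 ^ Suc n) (inverse \<rho>2 ^ Suc n) (axis k)" for k
  have contract_\<zeta>: "contract (Suc n) (\<zeta> k) = axis k" for k
    using \<rho> by (simp add: \<zeta>_def contract_def shear_shear flip: power_mult_distrib power_Suc)
  have "\<zeta> \<longlonglongrightarrow> shear \<gamma> (inverse \<rho>1 ^ Suc n) (inverse \<rho>2 ^ Suc n) 0"
    unfolding \<zeta>_def by (rule tendsto_shear[OF axis_tendsto_0])
  then have "(\<lambda>k. fourier \<nu> (\<zeta> k)) \<longlonglongrightarrow> fourier \<nu> 0"
    by (intro tendsto_fourier \<nu>) (simp add: shear_0)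
  then have "eventually (\<lambda>k. fourier \<nu> (\<zeta> k) \<noteq> 0) sequentially"
    by (rule tendsto_imp_eventually_ne) (simp add: fourier_0[OF \<nu>(1)])
  then obtain k where k: "fourier \<nu> (\<zeta> k) \<noteq> 0"
    by (auto simp: eventually_sequentially)
  have "cmod (fourier \<nu> (\<zeta> k)) \<le> cmod (mask D (axis k)) * cmod (fourier \<nu> (\<zeta> k))"
    using F.isolated_frequency[OF assms nz, of "\<zeta> k"] unfolding contract_\<zeta> .
  then have "1 \<le> cmod (mask D (axis k))"
    using k by simp
  then have "axis k \<bullet> vector [d11, 0] \<in> \<int>"
    using D by (intro mask_modulus_one)
  then have "axis k $ 1 * d11 \<in> \<int>"
    by (simp add: inner_d1)
  then show False
    using Ints_between[of "axis k $ 1 * d11"] axis_bounds[of k] D by (simp add: abs_mult mult.commute)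
qed

text \<open>
  Modulus 1 at \<open>x\<close> would propagate along the contracted orbit of \<open>x\<close> to all mask factors, so that
  \<open>\<rho>1 ^ n * x $ 1 * d11\<close> would be a null sequence of nonzero integers.
\<close>

lemma fourier_modulus_lt_1:
  assumes "x $ 1 \<noteq> 0"
  shows "cmod (fourier \<mu> x) < 1"
proof (rule ccontr)
  assume "\<not> ?thesis"
  then have 1: "cmod (fourier \<mu> x) \<ge> 1" by simp
  have step: "cmod (mask D (contract 1 y)) \<ge> 1 \<and> cmod (fourier \<mu> (contract 1 y)) \<ge> 1"
    if "cmod (fourier \<mu> y) \<ge> 1" for y
  proof -
    let ?a = "cmod (mask D (contract 1 y))" and ?b = "cmod (fourier \<mu> (contract 1 y))"
    have ab: "1 \<le> ?a * ?b"
      using that by (simp add: fourier_contract[of y] norm_mult)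
    have "?a * ?b \<le> ?a" "?a * ?b \<le> ?b"
      by (rule mult_left_le[OF norm_fourier_le[OF \<mu>] norm_ge_zero],
          rule mult_left_le_one_le[OF norm_ge_zero norm_ge_zero norm_mask_le])
    with ab show ?thesis by simp
  qed
  have "cmod (fourier \<mu> (contract n x)) \<ge> 1" for n
  proof (induction n)
    case (Suc n)
    then show ?case using step[of "contract n x"] by (simp add: contract_contract)
  qed (use 1 in simp)
  then have "cmod (mask D (contract (Suc n) x)) \<ge> 1" for n
    using step[of "contract n x"] by (simp add: contract_contract)
  then have int: "(contract (Suc n) x) $ 1 * d11 \<in> \<int>" for n
    unfolding inner_d1[symmetric] by (rule mask_modulus_one[OF D(1,2) _ D(3)])
  have "(\<lambda>n. \<rho>1 ^ Suc n) \<longlonglongrightarrow> 0"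
    using \<rho> by (intro LIMSEQ_Suc LIMSEQ_realpow_zero) auto
  then have "(\<lambda>n. \<bar>\<rho>1 ^ Suc n * x $ 1 * d11\<bar>) \<longlonglongrightarrow> 0"
    by (intro tendsto_rabs_zero tendsto_mult_left_zero)
  then have "eventually (\<lambda>n. \<bar>\<rho>1 ^ Suc n * x $ 1 * d11\<bar> < 1) sequentially"
    by (rule order_tendstoD(2)) simp
  then obtain n where "\<bar>\<rho>1 ^ Suc n * x $ 1 * d11\<bar> < 1"
    by (auto simp: eventually_sequentially)
  then show False
    using Ints_between[of "\<rho>1 ^ Suc n * x $ 1 * d11"] int[of n] D \<rho> assms by auto
qed

text \<open>
  If the relation were transitive, any pair \<open>l0\<close>, \<open>l1\<close> at level 1 would be twins for the first digit. Omitting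
  this digit leaves a contracted copy of \<open>\<mu>\<close>, so the comparison of twins bounds the transform of
  \<open>\<mu>\<close> near 0 by its values near the zero \<open>x\<close> of the mask. In the limit the transform would have
  modulus 1 at \<open>x\<close>.
\<close>

lemma first_level_not_transitive:
  obtains l0 l1 l where "l0 \<in> \<Lambda>" "l1 \<in> \<Lambda>" "l \<in> \<Lambda>" "l \<noteq> l1"
    "mask D (contract 1 (l0 - l1)) = 0" "mask D (contract 1 (l - l0)) = 0"
    "mask D (contract 1 (l - l1)) \<noteq> 0"
proof (rule ccontr)
  assume contr: "\<not> thesis"
  obtain F where "finite F" "F \<subseteq> \<Lambda>" "(\<Sum>l\<in>F. (cmod (fourier \<mu> (0 - l)))\<^sup>2) > 1 - (1::real)"
    using spectrum_almost_parseval[OF \<mu> spectrum, of 1 0] by auto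
  then obtain l0 where l0: "l0 \<in> \<Lambda>"
    by (cases "F = {}") auto
  obtain l1 where l1: "l1 \<in> \<Lambda>" "mask D (contract 1 (l1 - l0)) = 0"
    using every_level_occurs[OF l0, of 0] by auto
  define x where "x = contract 1 (l0 - l1)"
  have x: "mask D x = 0"
    using l1 mask_diff_sym unfolding x_def by blast
  obtain v where v: "real p * x $ 1 = of_int v" "\<not> int p dvd v"
    using zero_fst[OF x] by blast
  obtain \<nu> where \<nu>: "prob_space \<nu>" "sets \<nu> = sets borel"
    and \<nu>_eq: "\<And>\<xi>. fourier \<nu> \<xi> = fourier \<mu> (contract 1 \<xi>)"
    using omit_first unfolding contract_1 by blast
  have fac: "fourier \<mu> \<xi> = mask D (contract 1 \<xi>) * fourier \<nu> \<xi>" for \<xi>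
    unfolding \<nu>_eq by (rule fourier_contract)
  interpret F: digit_factor D "contract 1" \<mu> \<nu> \<Lambda>
    by (rule digit_factor.intro[OF D(1) D_ne \<mu> \<nu> spectrum contract_diff fac])
  have le: "cmod (fourier \<mu> (axis k)) \<le> cmod (fourier \<mu> (x + axis k))" for k
  proof -
    obtain \<eta> where \<eta>: "contract 1 \<eta> = axis k + contract 1 l0"
      by (rule contract_surj)
    then have *: "contract 1 (\<eta> - l0) = axis k" "contract 1 (\<eta> - l1) = x + axis k"
      by (simp_all add: contract_diff x_def)
    have "mask D (x + axis k) \<noteq> 0"
    proof
      assume "mask D (x + axis k) = 0"
      then obtain u where "real p * (x + axis k) $ 1 = of_int u"
        using zero_fst by blast
      then have "real p * axis k $ 1 = of_int (u - v)"
        using v by (simp add: distrib_left)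
      then have "real p * axis k $ 1 \<in> \<int>" by (metis Ints_of_int)
      then show False
        using Ints_between[of "real p * axis k $ 1"] axis_bounds[of k] p prime_gt_0_nat[OF p] by simp
    qed
    then have "cmod (fourier \<nu> (\<eta> - l0)) \<le> cmod (fourier \<nu> (\<eta> - l1))"
    proof (intro F.twin_frequencies l0 l1(1))
      show "mask D (contract 1 (l0 - l1)) = 0"
        using x unfolding x_def .
    next
      fix l assume "l \<in> \<Lambda> - {l0, l1}" "mask D (contract 1 (l - l0)) = 0"
      then show "mask D (contract 1 (l - l1)) = 0"
        using contr that[OF l0 l1(1), of l] x unfolding x_def by blast
    qed (simp add: * del: One_nat_def)
    then show ?thesis by (simp only: \<nu>_eq *)
  qed
  have "(\<lambda>k. cmod (fourier \<mu> (axis k))) \<longlonglongrightarrow> cmod (fourier \<mu> 0)"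
    by (intro tendsto_norm tendsto_fourier \<mu> axis_tendsto_0)
  moreover have "(\<lambda>k. cmod (fourier \<mu> (x + axis k))) \<longlonglongrightarrow> cmod (fourier \<mu> (x + 0))"
    by (intro tendsto_norm tendsto_fourier \<mu> tendsto_add tendsto_const axis_tendsto_0)
  ultimately have "cmod (fourier \<mu> 0) \<le> cmod (fourier \<mu> (x + 0))"
    by (rule LIMSEQ_le) (use le in blast)
  then have "1 \<le> cmod (fourier \<mu> x)"
    by (simp add: fourier_0[OF \<mu>(1)])
  moreover have "x $ 1 \<noteq> 0"
    using v by auto
  ultimately show False
    using fourier_modulus_lt_1[of x] by simp
qed

text \<open>
  In a triple violating transitivity the sum of two mask zeros is not a mask zero, hence an integer
  vector. So the outer difference \<open>\<eta>\<close> has an integer \<open>m\<close> as first coordinate after one contraction, while at its own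
  level \<open>s + 1\<close>, greater than 1, this coordinate is \<open>U / p\<close> with \<open>U\<close> prime to \<open>p\<close>. Comparison gives
  \<open>inverse \<rho>1 ^ s * U = p * m\<close>.
\<close>

lemma rational_expansion_power:
  obtains s A B where "s > 0" "inverse \<rho>1 ^ s = of_int A / of_int B" "A \<noteq> 0" "B \<noteq> 0"
    "int p dvd A" "\<not> int p dvd B"
proof -
  obtain l0 l1 l where l: "l0 \<in> \<Lambda>" "l1 \<in> \<Lambda>" "l \<in> \<Lambda>" "l \<noteq> l1"
    "mask D (contract 1 (l0 - l1)) = 0" "mask D (contract 1 (l - l0)) = 0"
    "mask D (contract 1 (l - l1)) \<noteq> 0"
    by (rule first_level_not_transitive)
  define \<eta> where "\<eta> = l - l1"
  have "contract 1 (l - l0) + contract 1 (l0 - l1) = contract 1 \<eta>"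
    by (simp add: contract_diff \<eta>_def)
  then have "contract 1 \<eta> \<in> int_lattice"
    using zero_add[OF l(6,5)] l(7) by (simp add: \<eta>_def)
  then have "\<rho>1 * \<eta> $ 1 \<in> \<int>"
    by (simp add: int_lattice_def forall_2)
  then obtain m where m: "\<rho>1 * \<eta> $ 1 = of_int m"
    by (rule Ints_cases)
  have "fourier \<mu> \<eta> = 0"
    unfolding \<eta>_def using spectrum l by (intro spectrum_orthogonal) auto
  then obtain s where s: "mask D (contract (Suc s) \<eta>) = 0"
    by (rule fourier_zero_level)
  have "s \<noteq> 0"
  proof
    assume "s = 0"
    with s l(7) show False by (simp add: \<eta>_def)
  qed
  obtain U where U: "real p * (\<rho>1 ^ Suc s * \<eta> $ 1) = of_int U" "\<not> int p dvd U"
    using zero_fst[OF s] by auto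
  have eq: "real p * (\<rho>1 ^ s * of_int m) = of_int U"
    using U(1) by (simp add: m[symmetric] mult_ac)
  have "m \<noteq> 0" using eq U(2) by auto
  have "U \<noteq> 0" using U(2) by auto
  have pow: "inverse \<rho>1 ^ s = of_int (int p * m) / of_int U"
  proof -
    have "inverse \<rho>1 ^ s * of_int U = of_int (int p * m) * (inverse \<rho>1 * \<rho>1) ^ s"
      unfolding power_mult_distrib eq[symmetric] by simp
    then have "inverse \<rho>1 ^ s * of_int U = of_int (int p * m)"
      using \<rho> by simp
    then show ?thesis
      using \<open>U \<noteq> 0\<close> by (subst nonzero_eq_divide_eq) simp_all
  qed
  obtain A B where AB: "inverse \<rho>1 ^ s = of_int A / of_int B" "B \<noteq> 0" "coprime A B"
  proof -
    let ?g = "gcd (int p * m) U"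
    have g: "?g \<noteq> 0" using \<open>U \<noteq> 0\<close> by simp
    have "inverse \<rho>1 ^ s = of_int ((int p * m) div ?g) / of_int (U div ?g)"
      unfolding pow using g by (simp add: real_of_int_div)
    moreover have "U div ?g \<noteq> 0" using \<open>U \<noteq> 0\<close> by (simp add: dvd_div_eq_0_iff)
    moreover have "coprime ((int p * m) div ?g) (U div ?g)"
      using \<open>U \<noteq> 0\<close> by (intro div_gcd_coprime) simp
    ultimately show thesis by (rule that)
  qed
  have "real_of_int A / of_int B = of_int (int p * m) / of_int U"
    using AB(1) pow by (rule trans[OF sym])
  then have "real_of_int (A * U) = real_of_int (int p * m * B)"
    using AB(2) \<open>U \<noteq> 0\<close> by (simp add: frac_eq_eq)
  then have "A * U = int p * m * B" by (simp only: of_int_eq_iff)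
  then have "int p dvd A * U" by simp
  then have pA: "int p dvd A"
    using p U(2) by (simp add: prime_dvd_mult_iff)
  moreover have "\<not> int p dvd B"
  proof
    assume "int p dvd B"
    then have "is_unit (int p)"
      by (rule coprime_common_divisor[OF AB(3) pA])
    then show False
      using prime_gt_1_nat[OF p] by simp
  qed
  moreover have "A \<noteq> 0"
    using AB(1) \<rho> by auto
  ultimately show thesis
    using that[of s A B] AB \<open>s \<noteq> 0\<close> by simp
qed

lemma rational_of_zero:
  assumes "mask D x = 0" shows "x $ 1 \<in> \<rat>" "x $ 2 \<in> \<rat>"
proof -
  have p0: "real p \<noteq> 0" using prime_gt_0_nat[OF p] by simp
  obtain v where "real p * x $ 1 = of_int v" using zero_fst[OF assms] by blast
  then have "x $ 1 = of_int v / real p" using p0 by (metis nonzero_mult_div_cancel_left)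
  then show "x $ 1 \<in> \<rat>" by simp
  obtain w where "real p * x $ 2 = of_int w" using zero_snd[OF assms] by (auto elim: Ints_cases)
  then have "x $ 2 = of_int w / real p" using p0 by (metis nonzero_mult_div_cancel_left)
  then show "x $ 2 \<in> \<rat>" by simp
qed

lemma level_fst:
  assumes "mask D (contract n \<eta>) = 0"
  obtains X :: int where "real p * \<eta> $ 1 = inverse \<rho>1 ^ n * of_int X" "\<not> int p dvd X"
proof -
  obtain X where X: "real p * (\<rho>1 ^ n * \<eta> $ 1) = of_int X" "\<not> int p dvd X"
    using zero_fst[OF assms] unfolding contract_fst by blast
  have "real p * \<eta> $ 1 = (inverse \<rho>1 * \<rho>1) ^ n * (real p * \<eta> $ 1)"
    using \<rho> by simp
  also have "\<dots> = inverse \<rho>1 ^ n * of_int X"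
    unfolding X(1)[symmetric] power_mult_distrib by (simp only: mult_ac)
  finally show thesis using X(2) by (rule that)
qed

text \<open>
  Measured by the exponent of \<open>p\<close> in the first coordinate, a difference at a higher level is smaller. So \<open>l\<close>
  and \<open>l'\<close>, at levels \<open>f * s + 1\<close> and \<open>(f + e) * s + 1\<close> from \<open>l0\<close>, differ at the lower of these levels.
  The level of \<open>l - l'\<close> is at first only some number \<open>m + 1\<close>, where \<open>m\<close> might not be a multiple
  of \<open>s\<close> and \<open>inverse \<rho>1 ^ m\<close> might be irrational. Raising the equation of first coordinates to the \<open>s\<close>-th
  power turns it into one between integers.
\<close>

lemma level_of_difference:
  assumes s: "inverse \<rho>1 ^ s = of_int A / of_int B" "A \<noteq> 0" "B \<noteq> 0" "int p dvd A" "\<not> int p dvd B"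
    and l: "l \<in> \<Lambda>" "l' \<in> \<Lambda>" "l0 \<in> \<Lambda>"
    and lev: "mask D (contract (Suc (f * s)) (l - l0)) = 0" "mask D (contract (Suc ((f + e) * s)) (l' - l0)) = 0"
    and e: "e > 0"
  shows "mask D (contract (Suc (f * s)) (l - l')) = 0"
proof -
  let ?a = "inverse \<rho>1"
  have a: "?a \<noteq> 0" using \<rho> by simp
  have pp: "prime (int p)" using p by simp
  obtain X where X: "real p * (l - l0) $ 1 = ?a ^ Suc (f * s) * of_int X" "\<not> int p dvd X"
    using level_fst[OF lev(1)] by blast
  obtain Y where Y: "real p * (l' - l0) $ 1 = ?a ^ Suc ((f + e) * s) * of_int Y" "\<not> int p dvd Y"
    using level_fst[OF lev(2)] by blast
  have pow: "\<not> int p dvd u ^ k" if "\<not> int p dvd u" for u k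
    using prime_dvd_power[OF pp] that by blast
  have mul: "\<not> int p dvd u * w" if "\<not> int p dvd u" "\<not> int p dvd w" for u w
    using that prime_dvd_mult_iff[OF pp] by blast
  define N where "N = B ^ e * X - A ^ e * Y"
  have N: "\<not> int p dvd N"
  proof
    assume "int p dvd N"
    moreover have "int p dvd A ^ e * Y" 
      by (rule dvd_mult2[OF dvd_trans[OF s(4) dvd_power]]) (simp add: e)
    ultimately have "int p dvd N + A ^ e * Y"
      by (rule dvd_add)
    then have "int p dvd B ^ e * X"
      by (simp add: N_def)
    then show False
      using mul[OF pow[OF s(5)] X(2)] by blast
  qed
  have sc: "?a ^ s * of_int B = of_int A" unfolding s(1) using s(3) by simp
  have ae: "?a ^ (e * s) * of_int B ^ e = of_int A ^ e"
  proof -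
    have "?a ^ (e * s) * of_int B ^ e = (?a ^ s) ^ e * of_int B ^ e"
      by (metis power_mult mult.commute)
    also have "\<dots> = of_int A ^ e"
      by (simp only: power_mult_distrib[symmetric] sc)
    finally show ?thesis .
  qed
  have diff: "real p * (l - l') $ 1 * of_int B ^ e = ?a * ?a ^ (f * s) * of_int N"
  proof -
    have "real p * (l - l') $ 1 = real p * (l - l0) $ 1 - real p * (l' - l0) $ 1"
      by (simp add: algebra_simps)
    also have "\<dots> = ?a * ?a ^ (f * s) * (of_int X - ?a ^ (e * s) * of_int Y)"
      unfolding X(1) Y(1) by (simp add: algebra_simps power_add)
    finally have d: "real p * (l - l') $ 1 = ?a * ?a ^ (f * s) * (of_int X - ?a ^ (e * s) * of_int Y)" .
    have "real p * (l - l') $ 1 * of_int B ^ e =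
      ?a * ?a ^ (f * s) * (of_int B ^ e * of_int X - (?a ^ (e * s) * of_int B ^ e) * of_int Y)"
      unfolding d by (simp add: algebra_simps)
    then show ?thesis unfolding ae N_def by simp
  qed
  have "N \<noteq> 0" using N by auto
  then have "l \<noteq> l'" using diff a by auto
  then have "fourier \<mu> (l - l') = 0"
    using l spectrum by (intro spectrum_orthogonal) auto
  then obtain m where m: "mask D (contract (Suc m) (l - l')) = 0"
    by (rule fourier_zero_level)
  obtain W where W: "real p * (l - l') $ 1 = ?a ^ Suc m * of_int W" "\<not> int p dvd W"
    using level_fst[OF m] by blast
  have eq: "?a ^ m * of_int (W * B ^ e) = ?a ^ (f * s) * of_int N"
    using diff a unfolding W(1) by simp
  define R where "R = W * B ^ e"
  have R: "\<not> int p dvd R"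
    unfolding R_def by (intro mul pow W s(5))
  have "(?a ^ m * of_int R) ^ s = (?a ^ (f * s) * of_int N) ^ s"
    unfolding R_def eq ..
  moreover have "(?a ^ k) ^ s = (?a ^ s) ^ k" for k
    by (metis power_mult mult.commute)
  ultimately have h: "(?a ^ s) ^ m * of_int R ^ s = (?a ^ s) ^ (f * s) * of_int N ^ s"
    by (simp only: power_mult_distrib)
  have Ak: "of_int A ^ k = (?a ^ s) ^ k * of_int B ^ k" for k
    by (simp only: sc[symmetric] power_mult_distrib)
  have "of_int A ^ m * (of_int B ^ (f * s) * of_int R ^ s) =
      ((?a ^ s) ^ m * of_int R ^ s) * (of_int B ^ m * of_int B ^ (f * s))"
    by (simp only: Ak mult_ac)
  also have "\<dots> = of_int A ^ (f * s) * (of_int B ^ m * of_int N ^ s)"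
    unfolding h by (simp only: Ak mult_ac)
  finally have "real_of_int (A ^ m * (B ^ (f * s) * R ^ s)) = of_int (A ^ (f * s) * (B ^ m * N ^ s))"
    by simp
  then have "A ^ m * (B ^ (f * s) * R ^ s) = A ^ (f * s) * (B ^ m * N ^ s)"
    by (simp only: of_int_eq_iff)
  then have "m = f * s"
    by (rule prime_power_balance[OF pp s(4) s(2) mul[OF pow[OF s(5)] pow[OF R]] mul[OF pow[OF s(5)] pow[OF N]]])
  with m show ?thesis by simp
qed

text \<open>
  With \<open>y\<close> the image of \<open>l3 - l0\<close> at level \<open>1 + 2 * s\<close>, the image at the levels \<open>1 + s\<close> and \<open>1\<close> is rational as
  well, because there it is a difference of two mask zeros: \<open>l3\<close> and \<open>l0\<close> are both at that level from \<open>l2\<close>,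
  respectively from \<open>l1\<close>.
\<close>

lemma rational_slope: "\<gamma> \<in> \<rat>"
proof -
  obtain s A B where s: "s > 0" "inverse \<rho>1 ^ s = of_int A / of_int B" "A \<noteq> 0" "B \<noteq> 0"
    "int p dvd A" "\<not> int p dvd B"
    by (rule rational_expansion_power)
  obtain l0 where l0: "l0 \<in> \<Lambda>"
    using first_level_not_transitive by blast
  obtain l1 where l1: "l1 \<in> \<Lambda>" "mask D (contract (Suc 0) (l1 - l0)) = 0"
    using every_level_occurs[OF l0] by blast
  obtain l2 where l2: "l2 \<in> \<Lambda>" "mask D (contract (Suc s) (l2 - l0)) = 0"
    using every_level_occurs[OF l0] by blast
  obtain l3 where l3: "l3 \<in> \<Lambda>" "mask D (contract (Suc (2 * s)) (l3 - l0)) = 0"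
    using every_level_occurs[OF l0] by blast
  have d13: "mask D (contract (Suc 0) (l1 - l3)) = 0"
    using level_of_difference[OF s(2-6) l1(1) l3(1) l0, of 0 2] l1(2) l3(2) by (simp add: mult_2)
  have d23: "mask D (contract (Suc s) (l2 - l3)) = 0"
    using level_of_difference[OF s(2-6) l2(1) l3(1) l0, of 1 1] l2(2) l3(2) by (simp add: mult_2)
  define y where "y = contract (Suc (2 * s)) (l3 - l0)"
  let ?\<alpha> = "inverse \<rho>1 ^ s" and ?\<beta> = "inverse \<rho>2 ^ s"
  have expand: "shear \<gamma> ?\<alpha> ?\<beta> (contract s \<xi>) = \<xi>" for \<xi>
    using \<rho> by (simp add: contract_def shear_shear flip: power_mult_distrib)
  have "y = contract s (contract (Suc s) (l3 - l0))"
    by (simp add: y_def contract_contract mult_2)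
  then have y1: "shear \<gamma> ?\<alpha> ?\<beta> y = contract (Suc s) (l3 - l0)"
    by (simp only: expand)
  have "contract (Suc s) (l3 - l0) = contract s (contract (Suc 0) (l3 - l0))"
    by (simp add: contract_contract)
  with y1 have y2: "shear \<gamma> (?\<alpha> * ?\<alpha>) (?\<beta> * ?\<beta>) y = contract (Suc 0) (l3 - l0)"
    by (simp only: shear_shear[symmetric] expand)
  have yz: "mask D y = 0" using l3 by (simp add: y_def)
  have "contract (Suc s) (l3 - l0) = contract (Suc s) (l2 - l0) - contract (Suc s) (l2 - l3)"
    "contract (Suc 0) (l3 - l0) = contract (Suc 0) (l1 - l0) - contract (Suc 0) (l1 - l3)"
    by (simp_all add: contract_diff)
  then have r: "shear \<gamma> ?\<alpha> ?\<beta> y $ 2 \<in> \<rat>" "shear \<gamma> (?\<alpha> * ?\<alpha>) (?\<beta> * ?\<beta>) y $ 2 \<in> \<rat>"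
    unfolding y1 y2 by (simp_all only: vector_minus_component Rats_diff rational_of_zero(2) l1 l2 d13 d23)
  show ?thesis
  proof (rule rational_orbit_imp_rational_slope[OF _ _ _ _ _ r])
    show "?\<alpha> \<in> \<rat>" unfolding s(2) by simp
    show "?\<alpha> \<noteq> ?\<beta>"
    proof
      assume "?\<alpha> = ?\<beta>"
      then have "inverse \<rho>1 = inverse \<rho>2"
        using s(1) \<rho> power_eq_imp_eq_base[of "inverse \<rho>1" s "inverse \<rho>2"] by simp
      then show False using \<rho> by simp
    qed
    show "y $ 1 \<in> \<rat>" "y $ 2 \<in> \<rat>" by (rule rational_of_zero[OF yz])+
    show "y $ 1 \<noteq> 0" using zero_fst[OF yz] by auto
  qed
qed

end

section \<open>Zeros of the digit mask as cosets of the integer lattice\<close>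

context
  fixes p :: nat and a :: "real ^ 2" and Z :: "(real ^ 2) set"
  assumes p: "prime p" and a: "a \<in> E_set p"
    and Z: "Z = (\<Union>j\<in>{1..p - 1}. (\<lambda>z. (real j / real p) *\<^sub>R a + z) ` int_lattice)"
begin

lemma coset_fst:
  assumes "x \<in> Z" shows "\<exists>v::int. real p * x $ 1 = of_int v \<and> \<not> int p dvd v"
proof -
  have p0: "p > 0" using p by (rule prime_gt_0_nat)
  obtain i1 i2 where i: "a = vector [real i1, real i2]" "i1 \<in> {1..p - 1}" "i2 \<in> {1..p - 1}"
    using a by (auto simp: E_set_def)
  obtain j z where j: "j \<in> {1..p - 1}" "z \<in> int_lattice" "x = (real j / real p) *\<^sub>R a + z"
    using assms unfolding Z by blast
  obtain m where m: "z $ 1 = of_int m"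
    using j(2) unfolding int_lattice_def by (auto elim: Ints_cases)
  have "real p * x $ 1 = of_int (int (j * i1) + int p * m)"
    using p0 by (simp add: j(3) i(1) m distrib_left)
  moreover have "\<not> p dvd j" "\<not> p dvd i1"
    using j(1) i(2) p0 by (auto dest!: dvd_imp_le)
  then have "\<not> int p dvd int (j * i1)"
    using p unfolding int_dvd_int_iff by (simp add: prime_dvd_mult_iff)
  then have "\<not> int p dvd int (j * i1) + int p * m"
    by (subst dvd_add_left_iff) simp_all
  ultimately show ?thesis by blast
qed

lemma coset_snd:
  assumes "x \<in> Z" shows "real p * x $ 2 \<in> \<int>"
proof -
  have p0: "p > 0" using p by (rule prime_gt_0_nat)
  obtain i1 i2 where i: "a = vector [real i1, real i2]"
    using a by (auto simp: E_set_def)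
  obtain j z where j: "z \<in> int_lattice" "x = (real j / real p) *\<^sub>R a + z"
    using assms unfolding Z by blast
  have "real p * x $ 2 = of_nat (j * i2) + of_nat p * z $ 2"
    using p0 by (simp add: j(2) i distrib_left)
  also have "\<dots> \<in> \<int>"
    using j(1) unfolding int_lattice_def by (intro Ints_add Ints_mult Ints_of_nat) auto
  finally show ?thesis .
qed

lemma coset_add:
  assumes "x \<in> Z" "y \<in> Z" shows "x + y \<in> Z \<or> x + y \<in> int_lattice"
proof -
  have p0: "p > 0" using p by (rule prime_gt_0_nat)
  obtain i1 i2 where i: "a = vector [real i1, real i2]"
    using a by (auto simp: E_set_def)
  obtain j z where j: "z \<in> int_lattice" "x = (real j / real p) *\<^sub>R a + z"
    using assms unfolding Z by blast
  obtain k w where k: "w \<in> int_lattice" "y = (real k / real p) *\<^sub>R a + w"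
    using assms unfolding Z by blast
  define r where "r = (j + k) mod p"
  define b where "b = real ((j + k) div p) *\<^sub>R a + (z + w)"
  have "a \<in> int_lattice" by (simp add: i int_lattice_def forall_2)
  then have b: "b \<in> int_lattice"
    using j(1) k(1) unfolding b_def by (simp add: int_lattice_def)
  have "real (j + k) = real r + real p * real ((j + k) div p)"
    unfolding r_def by (metis mod_mult_div_eq of_nat_add of_nat_mult)
  then have "real (j + k) / real p = real r / real p + real ((j + k) div p)"
    using p0 by (simp add: add_divide_distrib)
  moreover have "x + y = (real (j + k) / real p) *\<^sub>R a + (z + w)"
    unfolding j(2) k(2) by (simp add: add_divide_distrib scaleR_add_left)
  ultimately have xy: "x + y = (real r / real p) *\<^sub>R a + b"
    by (simp add: b_def scaleR_add_left)
  show ?thesis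
  proof (cases "r = 0")
    case True
    then show ?thesis using xy b by simp
  next
    case False
    then have "r \<in> {1..p - 1}"
      using mod_less_divisor[OF p0, of "j + k"] unfolding r_def[symmetric] by auto
    then show ?thesis using xy b unfolding Z by blast
  qed
qed

end

section \<open>Self-affine measures of triangular matrices\<close>

lemma matrix_inv_right_vec:
  fixes M N :: "real ^ 'n ^ 'n"
  assumes "M ** N = mat 1" "N ** M = mat 1"
  shows "M *v (matrix_inv M *v x) = x"
proof -
  have "M ** matrix_inv M = mat 1"
    unfolding matrix_inv_def using assms by (metis (mono_tags, lifting) someI_ex)
  then show ?thesis
    by (simp add: matrix_vector_mul_assoc)
qed

lemma adjoint_inverse_triangular:
  fixes \<rho>1 \<rho>2 c :: real
  assumes \<rho>: "\<rho>1 > 0" "\<rho>2 > 0" "\<rho>1 \<noteq> \<rho>2"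
    and M: "M = vector [vector [inverse \<rho>1, c], vector [0, inverse \<rho>2]]"
  shows "\<xi> \<bullet> (matrix_inv M *v x) = shear (c / (inverse \<rho>1 - inverse \<rho>2)) \<rho>1 \<rho>2 \<xi> \<bullet> x"
proof -
  define N :: "real ^ 2 ^ 2" where "N = vector [vector [\<rho>1, - c * \<rho>1 * \<rho>2], vector [0, \<rho>2]]"
  have inv: "M ** N = mat 1" "N ** M = mat 1"
    using \<rho> by (simp_all add: M N_def matrix_matrix_mult_def mat_def vec_eq_iff forall_2 sum_2)
  define y where "y = matrix_inv M *v x"
  have x: "x = M *v y"
    unfolding y_def by (rule matrix_inv_right_vec[OF inv, symmetric])
  have x1: "x $ 1 = inverse \<rho>1 * y $ 1 + c * y $ 2" and x2: "x $ 2 = inverse \<rho>2 * y $ 2"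
    by (simp_all add: x M matrix_vector_mult_def sum_2)
  have g: "c / (inverse \<rho>1 - inverse \<rho>2) * (\<rho>1 - \<rho>2) = - c * \<rho>1 * \<rho>2"
    using \<rho> by (simp add: field_simps)
  have "shear (c / (inverse \<rho>1 - inverse \<rho>2)) \<rho>1 \<rho>2 \<xi> \<bullet> x = \<xi> \<bullet> y"
    unfolding inner_vec_def sum_2 shear_components g x1 x2 using \<rho> by (simp add: field_simps)
  then show ?thesis by (simp add: y_def)
qed

context
  fixes D :: "(real ^ 2) set" and A S :: "real ^ 2 \<Rightarrow> real ^ 2" and \<mu> :: "(real ^ 2) measure"
  assumes D: "finite D" "D \<noteq> {}" and A: "A \<in> borel_measurable borel"
    and adj: "\<And>\<xi> x. expo \<xi> (A x) = expo (S \<xi>) x"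
    and \<mu>: "prob_space \<mu>" "sets \<mu> = sets borel"
begin

lemma omit_first_digit:
  "\<exists>\<nu>. prob_space \<nu> \<and> sets \<nu> = sets borel \<and> (\<forall>\<xi>. fourier \<nu> \<xi> = fourier \<mu> (S \<xi>))"
proof (intro exI conjI allI)
  have Am: "A \<in> \<mu> \<rightarrow>\<^sub>M borel"
    unfolding measurable_cong_sets[OF \<mu>(2) refl] by (rule A)
  show "prob_space (distr \<mu> borel A)"
    by (rule prob_space.prob_space_distr[OF \<mu>(1) Am])
  show "sets (distr \<mu> borel A) = sets borel" by simp
  show "fourier (distr \<mu> borel A) \<xi> = fourier \<mu> (S \<xi>)" for \<xi>
    unfolding fourier_def by (subst integral_distr[OF Am]) (simp_all add: adj)
qed

text \<open>
  The measure for the digit \<open>n + 2\<close> arises from the one for the digit \<open>n + 1\<close> by averaging over a new first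
  digit.
\<close>

lemma omit_later_digit:
  assumes step: "\<And>\<xi>. fourier \<mu> \<xi> = mask D (S \<xi>) * fourier \<mu> (S \<xi>)"
  shows "\<exists>\<nu>. prob_space \<nu> \<and> sets \<nu> = sets borel \<and>
    (\<forall>\<xi>. fourier \<mu> \<xi> = mask D ((S ^^ Suc n) \<xi>) * fourier \<nu> \<xi>)"
proof (induction n)
  case 0
  obtain \<nu> where \<nu>: "prob_space \<nu>" "sets \<nu> = sets borel"
    and fac: "\<And>\<xi>. fourier \<nu> \<xi> = fourier \<mu> (S \<xi>)"
    using omit_first_digit by blast
  have "fourier \<mu> \<xi> = mask D ((S ^^ Suc 0) \<xi>) * fourier \<nu> \<xi>" for \<xi>
    unfolding fac by (simp add: step[symmetric])
  with \<nu> show ?case by blast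
next
  case (Suc n)
  then obtain \<nu> where \<nu>: "prob_space \<nu>" "sets \<nu> = sets borel"
    and fac: "\<And>\<xi>. fourier \<mu> \<xi> = mask D ((S ^^ Suc n) \<xi>) * fourier \<nu> \<xi>"
    by blast
  show ?case
  proof (intro exI conjI allI)
    show "prob_space (digit_average D A \<nu>)"
      by (rule prob_space_digit_average[OF D A \<nu>])
    show "sets (digit_average D A \<nu>) = sets borel"
      by (rule sets_digit_average)
    fix \<xi>
    have "fourier \<mu> \<xi> = mask D (S \<xi>) * (mask D ((S ^^ Suc n) (S \<xi>)) * fourier \<nu> (S \<xi>))"
      by (subst step, subst fac) (rule refl)
    then show "fourier \<mu> \<xi> = mask D ((S ^^ Suc (Suc n)) \<xi>) * fourier (digit_average D A \<nu>) \<xi>"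
      by (simp add: fourier_digit_average[OF D A \<nu> adj] funpow_swap1 mult_ac)
  qed
qed

end

lemma self_affine_eq_digit_average:
  assumes "finite D" "D \<noteq> {}" "self_affine_measure M D \<mu>"
  shows "\<mu> = digit_average D ((*v) (matrix_inv M)) \<mu>"
proof -
  let ?A = "(*v) (matrix_inv M)"
  have A: "?A \<in> borel_measurable borel"
    by (intro borel_measurable_continuous_onI linear_continuous_on) (simp add: linear_conv_bounded_linear[symmetric])
  have \<mu>: "prob_space \<mu>" "sets \<mu> = sets borel"
    using assms(3) by (auto simp: self_affine_measure_def)
  interpret P: prob_space \<mu> by fact
  interpret Q: prob_space "digit_average D ?A \<mu>"
    by (rule prob_space_digit_average[OF assms(1,2) A \<mu>])
  show ?thesis
  proof (rule measure_eqI)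
    show "sets \<mu> = sets (digit_average D ?A \<mu>)"
      by (simp only: \<mu>(2) sets_digit_average)
    fix X assume "X \<in> sets \<mu>"
    then have X: "X \<in> sets borel" by (simp add: \<mu>(2))
    have "measure \<mu> X = measure (digit_average D ?A \<mu>) X"
      unfolding measure_digit_average[OF assms(1,2) A \<mu> X]
      using assms(3) X unfolding self_affine_measure_def affine_map_def by simp
    then show "emeasure \<mu> X = emeasure (digit_average D ?A \<mu>) X"
      by (simp add: P.emeasure_eq_measure Q.emeasure_eq_measure)
  qed
qed

theorem theorem1p4:
  fixes p :: nat and \<rho>1 \<rho>2 c d11 :: real and M :: "real ^ 2 ^ 2"
    and d :: "nat \<Rightarrow> real ^ 2" and D :: "(real ^ 2) set" and \<mu> :: "(real ^ 2) measure"
  assumes "prime p"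
    and "0 < \<rho>1" "\<rho>1 < 1" "0 < \<rho>2" "\<rho>2 < 1" "\<rho>1 \<noteq> \<rho>2"
    and "M = vector [vector [inverse \<rho>1, c], vector [0, inverse \<rho>2]]"
    and "D = d ` {0..p - 1}" "inj_on d {0..p - 1}" "D \<subseteq> int_lattice"
    and "d 0 = vector [0, 0]" "d 1 = vector [d11, 0]" "d11 \<noteq> 0"
    and "\<exists>a\<in>E_set p. zero_set (fourier (uniform_delta D)) =
           (\<Union>j\<in>{1..p - 1}. (\<lambda>z. (real j / real p) *\<^sub>R a + z) ` int_lattice)"
    and "self_affine_measure M D \<mu>"
    and "c / (inverse \<rho>1 - inverse \<rho>2) \<notin> \<rat>"
  shows "\<not> spectral_measure \<mu>"
proof
  assume "spectral_measure \<mu>"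
  then obtain \<Lambda> where \<Lambda>: "is_spectrum \<mu> \<Lambda>"
    by (auto simp: spectral_measure_def)
  define \<gamma> where "\<gamma> = c / (inverse \<rho>1 - inverse \<rho>2)"
  let ?A = "(*v) (matrix_inv M)" and ?S = "shear \<gamma> \<rho>1 \<rho>2"
  have v0: "vector [0, 0] = (0 :: real ^ 2)"
    by (simp add: vec_eq_iff forall_2)
  have "2 \<le> p" using assms(1) by (rule prime_ge_2_nat)
  then have D: "finite D" "D \<noteq> {}" "0 \<in> D" "vector [d11, 0] \<in> D"
    using assms(8,11,12) v0 by (auto intro: image_eqI[of _ d 0] image_eqI[of _ d 1])
  have \<mu>: "prob_space \<mu>" "sets \<mu> = sets borel"
    using assms(15) by (auto simp: self_affine_measure_def)
  obtain a where a: "a \<in> E_set p"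
    and Z: "{x. mask D x = 0} = (\<Union>j\<in>{1..p - 1}. (\<lambda>z. (real j / real p) *\<^sub>R a + z) ` int_lattice)"
    using assms(14) unfolding fourier_uniform_delta[OF D(1,2)] zero_set_def by blast
  have A: "?A \<in> borel_measurable borel"
    by (intro borel_measurable_continuous_onI linear_continuous_on) (simp add: linear_conv_bounded_linear[symmetric])
  have adj: "expo \<xi> (?A x) = expo (?S \<xi>) x" for \<xi> x
    unfolding expo_def adjoint_inverse_triangular[OF assms(2,4,6,7)] \<gamma>_def ..
  have step: "fourier \<mu> \<xi> = mask D (?S \<xi>) * fourier \<mu> (?S \<xi>)" for \<xi>
    using fourier_digit_average[OF D(1,2) A \<mu> adj, of \<xi>]
    unfolding self_affine_eq_digit_average[OF D(1,2) assms(15), symmetric] .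
  have S_pow: "(?S ^^ n) \<xi> = shear \<gamma> (\<rho>1 ^ n) (\<rho>2 ^ n) \<xi>" for n \<xi>
    by (induction n) (simp_all add: shear_shear)
  interpret triangular_spectral_system p D d11 \<gamma> \<rho>1 \<rho>2 \<mu> \<Lambda>
  proof (rule triangular_spectral_system.intro)
    show "\<exists>v::int. real p * x $ 1 = of_int v \<and> \<not> int p dvd v" if "mask D x = 0" for x
      using coset_fst[OF assms(1) a Z, of x] that by simp
    show "real p * x $ 2 \<in> \<int>" if "mask D x = 0" for x
      using coset_snd[OF assms(1) a Z, of x] that by simp
    show "mask D (x + y) = 0 \<or> x + y \<in> int_lattice" if "mask D x = 0" "mask D y = 0" for x y
      using coset_add[OF assms(1) a Z, of x y] that by simp
    show "\<exists>\<nu>. prob_space \<nu> \<and> sets \<nu> = sets borel \<and>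
       (\<forall>\<xi>. fourier \<mu> \<xi> = mask D (shear \<gamma> (\<rho>1 ^ Suc n) (\<rho>2 ^ Suc n) \<xi>) * fourier \<nu> \<xi>)" for n
      using omit_later_digit[OF D(1,2) A adj \<mu> step, of n] unfolding S_pow .
    show "\<exists>\<nu>. prob_space \<nu> \<and> sets \<nu> = sets borel \<and> (\<forall>\<xi>. fourier \<nu> \<xi> = fourier \<mu> (?S \<xi>))"
      by (rule omit_first_digit[OF D(1,2) A adj \<mu>])
  qed (fact assms D \<mu> \<Lambda> step)+
  show False
    using rational_slope assms(16) by (simp add: \<gamma>_def)
qed

end
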